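(* Let $P(\lambda)=\lambda^2A+\lambda Q+\epsilon A^{\star}$ be a $(\star,\epsilon)$-palindromic quadratic matrix polynomial over $\mathbb{K}$ with $A\in\mathbb{K}^{n\times n}$ nonsingular. Suppose that $(X,J)$ is a standard pair of $P(\lambda)$ partitioned as $$J=\mathrm{diag}(\Lambda_1,\Lambda_2),\qquad X=[Y_1,\ Y_2],\qquad Y_1\in\mathbb{K}^{n\times p},\ \Lambda_1\in\mathbb{K}^{p\times p},$$ and let $\tilde\Lambda_1\in\mathbb{K}^{p\times p}$ be a nonsingular matrix with $\sigma(\tilde\Lambda_1)=\{\tilde\lambda_j\}_{j=1}^p$, the set of prescribed eigenvalues. If $\sigma(\Lambda_1)\cap\sigma(\Lambda_2^{-\star})=\emptyset$, then for any nonsingular matrix $\Phi\in\mathbb{K}^{p\times p}$ and any $\tilde\Gamma_1\in\mathcal{S}_{(\tilde\Lambda_1,\star,\epsilon)}$ which satisfy $$\Phi\tilde\Gamma_1\Phi^{\star}=\Gamma_1,$$ where $$\Gamma_1=\left([Y_1^{\star},\ \Lambda_1^{-\star}Y_1^{\star}]\begin{bmatrix}Q&A\\ A&0\end{bmatrix}\begin{bmatrix}Y_1\\ Y_1\Lambda_1\end{bmatrix}\right)^{-1},$$ the matrices $$\tilde A=\left(A^{-1}+(\tilde Y_1\tilde\Lambda_1\tilde\Gamma_1\tilde Y_1^{\star}-Y_1\Lambda_1\Gamma_1Y_1^{\star})\right)^{-1},$$ $$\tilde Q=\tilde AA^{-1}QA^{-1}\tilde A+\tilde A\left(Y_1\Lambda_1^2\Gamma_1Y_1^{\star}-\tilde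 Y_1\tilde\Lambda_1^2\tilde\Gamma_1\tilde Y_1^{\star}\right)\tilde A,$$ with $\tilde Y_1=Y_1\Phi$, form a solution of the no spill-over palindromic model updating problem (PMUP).
   Context: $\mathbb{K}\in\{\mathbb{R},\mathbb{C}\}$, $\epsilon\in\{1,-1\}$, and $\star\in\{H,T\}$ denotes conjugate transpose or transpose; $B^{-\star}=(B^{-1})^{\star}$; $\sigma(B)$ is the set of all eigenvalues of $B$. A $(\star,\epsilon)$-palindromic quadratic matrix polynomial is $P(\lambda)=\lambda^2A+\lambda Q+\epsilon A^{\star}$ with $A,Q\in\mathbb{K}^{n\times n}$ and $Q^{\star}=\epsilon Q$. A pair $(X,J)\in\mathbb{K}^{n\times 2n}\times\mathbb{K}^{2n\times 2n}$ is a standard pair of $P(\lambda)$ if $\begin{bmatrix}X\\ XJ\end{bmatrix}$ is nonsingular and $AXJ^2+QXJ+\epsilon A^{\star}X=0$. (Then $J$ is nonsingular because $A$ is.) For a nonsingular $B\in\mathbb{K}^{m\times m}$, $\mathcal{S}_{(B,\star,\epsilon)}=\{S\in\mathbb{K}^{m\times m}: S^{\star}=-\epsilon S,\ BS=SB^{-\star}\}$. PMUP: given the system $(A,Q)$ and $p$ of its eigenpairs, update it to a new system $(\tilde A,\tilde Q)$ with $\tilde Q^{\star}=\epsilon\tilde Q$ such that these $p$ eigenpairs, represented by $(Y_1,\Lambda_1)$, are replaced by $p$ new prescribed ones, represented by $(\tilde Y_1,\tilde\Lambda_1)$, and the remaining $2n-p$ eigenpairs, represented by $(Y_2,\Lambda_2)$,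 are kept unchanged; in matrix form, $\tilde A\tilde Y_1\tilde\Lambda_1^2+\tilde Q\tilde Y_1\tilde\Lambda_1+\epsilon\tilde A^{\star}\tilde Y_1=0$ and $\tilde AY_2\Lambda_2^2+\tilde QY_2\Lambda_2+\epsilon\tilde A^{\star}Y_2=0$.
   Formalization: The matrix A^{-1} + (Ỹ₁Λ̃₁Γ̃₁Ỹ₁^⋆ − Y₁Λ₁Γ₁Y₁^⋆), whose inverse defines Ã, is additionally assumed nonsingular; this does not follow from the other hypotheses, and without it Ã is undefined. *)

theory Defs
  imports
    "Jordan_Normal_Form.Gauss_Jordan_Elimination"
    "Jordan_Normal_Form.Schur_Decomposition"
    "Jordan_Normal_Form.Spectral_Radius"
begin

text \<open>
  Both base fields are treated as subfields of the complex numbers: \<open>K\<close> is either \<open>\<real>\<close> or \<open>UNIV\<close>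
  (as sets of complex numbers), and an \<open>m\<close> by \<open>n\<close> matrix over \<open>K\<close> is a complex matrix with entries
  in \<open>K\<close>. In this way \<open>spectrum\<close> is the set of all complex eigenvalues, also for a real matrix.

  The parameter \<open>st\<close> stands for the operation \<open>B \<mapsto> B\<^sup>\<star>\<close>; it is either \<open>mat_adjoint\<close> or
  \<open>transpose_mat\<close>.
\<close>

definition mats :: "complex set \<Rightarrow> nat \<Rightarrow> nat \<Rightarrow> complex mat set" where
  "mats K m n = {B \<in> carrier_mat m n. elements_mat B \<subseteq> K}"

text \<open>Only meaningful for invertible arguments: on other matrices this is \<open>the None\<close>.\<close>

definition minv :: "complex mat \<Rightarrow> complex mat" where
  "minv B = the (mat_inverse B)"

lemma minv:
  assumes B: "B \<in> carrier_mat n n" and inv: "invertible_mat B"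
  shows "B * minv B = 1\<^sub>m n" "minv B * B = 1\<^sub>m n" "minv B \<in> carrier_mat n n"
proof -
  from inv obtain C where C: "B * C = 1\<^sub>m (dim_row B)" "C * B = 1\<^sub>m (dim_row C)"
    unfolding invertible_mat_def inverts_mat_def by blast
  have "dim_col C = n"
    using arg_cong[OF C(1), of dim_col] B by simp
  moreover have "dim_row C = n"
    using arg_cong[OF C(2), of dim_col] B by simp
  ultimately have "C \<in> carrier_mat n n"
    by auto
  with B C have "B \<in> Units (ring_mat TYPE(complex) n ())"
    by (auto simp: Units_def ring_mat_simps)
  then obtain D where D: "mat_inverse B = Some D"
    using mat_inverse(1)[OF B, of "()"] by fastforce
  from mat_inverse(2)[OF B D] D
  show "B * minv B = 1\<^sub>m n" "minv B * B = 1\<^sub>m n" "minv B \<in> carrier_mat n n"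
    by (auto simp: minv_def)
qed

definition append_cols :: "complex mat \<Rightarrow> complex mat \<Rightarrow> complex mat"  (infixr \<open>@\<^sub>c\<close> 65) where
  "B @\<^sub>c C = four_block_mat B C (0\<^sub>m 0 (dim_col B)) (0\<^sub>m 0 (dim_col C))"

text \<open>The polynomial \<open>\<lambda>\<^sup>2 A + \<lambda> Q + \<epsilon> A\<^sup>\<star>\<close> is represented by its coefficients \<open>A\<close> and \<open>Q\<close>.\<close>

definition palindromic_quadratic ::
  "complex set \<Rightarrow> nat \<Rightarrow> (complex mat \<Rightarrow> complex mat) \<Rightarrow> complex \<Rightarrow> complex mat \<Rightarrow> complex mat \<Rightarrow> bool"
  where
  "palindromic_quadratic K n st eps A Q \<longleftrightarrow>
     A \<in> mats K n n \<and> Q \<in> mats K n n \<and> st Q = eps \<cdot>\<^sub>m Q"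

definition standard_pair ::
  "complex set \<Rightarrow> nat \<Rightarrow> (complex mat \<Rightarrow> complex mat) \<Rightarrow> complex \<Rightarrow> complex mat \<Rightarrow> complex mat
     \<Rightarrow> complex mat \<Rightarrow> complex mat \<Rightarrow> bool"
  where
  "standard_pair K n st eps A Q X J \<longleftrightarrow>
     X \<in> mats K n (2 * n) \<and> J \<in> mats K (2 * n) (2 * n) \<and>
     invertible_mat (X @\<^sub>r (X * J)) \<and>
     A * X * (J * J) + Q * X * J + eps \<cdot>\<^sub>m (st A * X) = 0\<^sub>m n (2 * n)"

text \<open>The set \<open>\<S>\<close> attached to a nonsingular \<open>m\<close> by \<open>m\<close> matrix \<open>B\<close>.\<close>

definition S_set ::
  "complex set \<Rightarrow> nat \<Rightarrow> (complex mat \<Rightarrow> complex mat) \<Rightarrow> complex \<Rightarrow> complex mat \<Rightarrow> complex mat set"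
  where
  "S_set K m st eps B =
     {S \<in> mats K m m. st S = (- eps) \<cdot>\<^sub>m S \<and> B * S = S * st (minv B)}"

text \<open>
  The pair \<open>(At, Qt)\<close> solves the no spill-over updating problem with new eigenpairs \<open>(Yt1, Lt1)\<close>
  and kept eigenpairs \<open>(Y2, L2)\<close>.
\<close>

definition pmup_solution ::
  "complex set \<Rightarrow> nat \<Rightarrow> nat \<Rightarrow> (complex mat \<Rightarrow> complex mat) \<Rightarrow> complex \<Rightarrow> complex mat \<Rightarrow> complex mat
     \<Rightarrow> complex mat \<Rightarrow> complex mat \<Rightarrow> complex mat \<Rightarrow> complex mat \<Rightarrow> bool"
  where
  "pmup_solution K n p st eps Yt1 Lt1 Y2 L2 At Qt \<longleftrightarrow>
     palindromic_quadratic K n st eps At Qt \<and>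
     At * Yt1 * (Lt1 * Lt1) + Qt * Yt1 * Lt1 + eps \<cdot>\<^sub>m (st At * Yt1) = 0\<^sub>m n p \<and>
     At * Y2 * (L2 * L2) + Qt * Y2 * L2 + eps \<cdot>\<^sub>m (st At * Y2) = 0\<^sub>m n (2 * n - p)"

end

theory Submission
  imports Defs
begin

text \<open>
  Write \<open>U\<close> for the matrix with block rows \<open>X\<close> and \<open>X J\<close>, \<open>V\<close> for the matrix with block columns
  \<open>X\<^sup>\<star>\<close> and \<open>J\<^sup>-\<^sup>\<star> X\<^sup>\<star>\<close>, and \<open>B\<close> for the linearisation with rows \<open>(Q, A)\<close> and \<open>(A, 0)\<close>. The Gram
  matrix \<open>G = V B U\<close> inherits two symmetries from the palindromic structure: \<open>G J = J\<^sup>-\<^sup>\<star> G\<close> and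
  \<open>G\<^sup>\<star> = - \<epsilon> G\<close> (\<open>gram_intertwines\<close>, \<open>gram_star\<close>). By the first one, the block of \<open>G\<close> in position
  (2,1) solves the homogeneous Sylvester equation \<open>H \<Lambda>\<^sub>1 = \<Lambda>\<^sub>2\<^sup>-\<^sup>\<star> H\<close>. Disjointness of the two spectra
  forces it to vanish (\<open>sylvester_unique\<close>), and by the second symmetry so does the block in position
  (1,2). Hence \<open>G\<close> is block diagonal. It is invertible because \<open>U\<close>, \<open>V\<close> and \<open>B\<close> are, so both
  diagonal blocks are invertible, and the first of them is the matrix whose inverse is \<open>\<Gamma>\<^sub>1\<close>.

  With \<open>\<Gamma> = diag(\<Gamma>\<^sub>1, \<Gamma>\<^sub>2)\<close> the inverse of \<open>G\<close>, the identity \<open>G = V B U\<close> becomes \<open>U \<Gamma> V = B\<^sup>-\<^sup>1\<close>. Its blocks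
  say that the moments \<open>X J\<^sup>k \<Gamma> X\<^sup>\<star>\<close> for \<open>k = 0, 1, 2\<close> are \<open>0\<close>, \<open>A\<^sup>-\<^sup>1\<close> and \<open>- A\<^sup>-\<^sup>1 Q A\<^sup>-\<^sup>1\<close>
  (\<open>spectral_sums\<close>).

  Conversely, these three moments together with the symmetries of \<open>\<Gamma>\<close> already imply that \<open>(X, J)\<close>
  satisfies the quadratic equation and that \<open>Q\<^sup>\<star> = \<epsilon> Q\<close> (\<open>inverse_problem\<close>). This is applied to the
  data in which \<open>(Y\<^sub>1, \<Lambda>\<^sub>1, \<Gamma>\<^sub>1)\<close> is exchanged for the prescribed triple and \<open>(Y\<^sub>2, \<Lambda>\<^sub>2, \<Gamma>\<^sub>2)\<close> is kept. The
  condition linking \<open>\<Phi>\<close> to \<open>\<Gamma>\<^sub>1\<close> says that the zeroth moment does not change, and the formulas for the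
  new coefficients say that the first and second moments are those of the new system.

  In the lemmas \<open>L\<close>, \<open>N\<close> and \<open>g\<close> stand for \<open>\<Lambda>\<close>, \<open>\<Lambda>\<^sup>-\<^sup>1\<close> and \<open>\<Gamma>\<close>, with an index where there are two blocks.
\<close>

section \<open>Matrix algebra with side conditions on dimensions\<close>

text \<open>
  The usual laws of matrix algebra, with hypotheses that are equations between dimensions. In this
  form the simplifier can discharge them by computing the dimensions of both factors, without
  having to guess the intermediate format of a product.
\<close>

lemma mult_assoc_dim:
  fixes A B C :: "complex mat"
  assumes "dim_col A = dim_row B" "dim_col B = dim_row C"
  shows "(A * B) * C = A * (B * C)"
  by (rule assoc_mult_mat[of A _ "dim_row B" B "dim_row C" C]) (use assms in auto)

lemma mult_add_dim:
  fixes A B C :: "complex mat"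
  assumes "dim_col A = dim_row B" "dim_row C = dim_row B" "dim_col C = dim_col B"
  shows "A * (B + C) = A * B + A * C"
  by (rule mult_add_distrib_mat[of A _ "dim_row B" B "dim_col B"]) (use assms in auto)

lemma add_mult_dim:
  fixes A B C :: "complex mat"
  assumes "dim_col A = dim_row C" "dim_row A = dim_row B" "dim_col A = dim_col B"
  shows "(A + B) * C = A * C + B * C"
  by (rule add_mult_distrib_mat[of A "dim_row B" "dim_row C"]) (use assms in auto)

lemma mult_smult_dim:
  fixes A B :: "complex mat"
  assumes "dim_col A = dim_row B"
  shows "A * (c \<cdot>\<^sub>m B) = c \<cdot>\<^sub>m (A * B)"
  by (rule mult_smult_distrib[of A _ "dim_row B" B]) (use assms in auto)

lemma smult_mult_dim:
  fixes A B :: "complex mat"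
  assumes "dim_col A = dim_row B"
  shows "(c \<cdot>\<^sub>m A) * B = c \<cdot>\<^sub>m (A * B)"
  by (rule mult_smult_assoc_mat[of A _ "dim_row B" B]) (use assms in auto)

lemma one_mult_dim: "dim_row A = n \<Longrightarrow> 1\<^sub>m n * A = (A :: complex mat)"
  by (rule left_mult_one_mat'[of A]) 

lemma mult_one_dim: "dim_col A = n \<Longrightarrow> A * 1\<^sub>m n = (A :: complex mat)"
  by (rule right_mult_one_mat'[of A]) 

lemma zero_mult_dim: "dim_row A = m \<Longrightarrow> 0\<^sub>m k m * A = (0\<^sub>m k (dim_col A) :: complex mat)"
  by (rule left_mult_zero_mat[of A m]) auto

lemma mult_zero_dim: "dim_col A = m \<Longrightarrow> A * 0\<^sub>m m k = (0\<^sub>m (dim_row A) k :: complex mat)"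
  by (rule right_mult_zero_mat[of A _ m]) auto

lemma smult_smult_dim: "a \<cdot>\<^sub>m (b \<cdot>\<^sub>m A) = (a * b) \<cdot>\<^sub>m (A :: complex mat)"
  by (intro eq_matI) auto

lemma smult_add_dim:
  "dim_row A = dim_row B \<Longrightarrow> dim_col A = dim_col B \<Longrightarrow> c \<cdot>\<^sub>m (A + B) = c \<cdot>\<^sub>m A + c \<cdot>\<^sub>m (B :: complex mat)"
  by (intro eq_matI) (auto simp: algebra_simps)

lemma smult_zero_dim: "c \<cdot>\<^sub>m 0\<^sub>m a b = (0\<^sub>m a b :: complex mat)"
  by (intro eq_matI) auto

lemma add_zero_dim: "dim_row A = a \<Longrightarrow> dim_col A = b \<Longrightarrow> A + 0\<^sub>m a b = (A :: complex mat)"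
  "dim_row A = a \<Longrightarrow> dim_col A = b \<Longrightarrow> 0\<^sub>m a b + A = (A :: complex mat)"
  by (intro eq_matI; auto)+

lemma one_smult_dim: "1 \<cdot>\<^sub>m A = (A :: complex mat)"
  by (intro eq_matI) auto

lemmas mat_alg = mult_assoc_dim mult_add_dim add_mult_dim mult_smult_dim smult_mult_dim
  one_mult_dim mult_one_dim zero_mult_dim mult_zero_dim smult_smult_dim smult_add_dim
  smult_zero_dim add_zero_dim one_smult_dim

lemma cancel_left_dim:
  fixes B C X :: "complex mat"
  assumes "B * C = 1\<^sub>m n" "dim_col B = dim_row C" "dim_col C = dim_row X" "dim_row X = n"
  shows "B * (C * X) = X"
  using assms by (simp add: one_mult_dim flip: mult_assoc_dim)

lemma inverse_unique:
  fixes B C D :: "complex mat"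
  assumes "B \<in> carrier_mat n n" "C \<in> carrier_mat n n" "D \<in> carrier_mat n n"
    and "B * C = 1\<^sub>m n" "D * B = 1\<^sub>m n"
  shows "C = D"
proof -
  have "C = (D * B) * C" using assms by (simp add: mat_alg)
  also have "\<dots> = D * (B * C)" using assms by (intro mult_assoc_dim) auto
  also have "\<dots> = D" using assms by (simp add: mat_alg)
  finally show ?thesis .
qed

lemma invertible_if_right_inverse:
  assumes "B \<in> carrier_mat n n" "C \<in> carrier_mat n n" "B * C = 1\<^sub>m n"
  shows "invertible_mat (B :: complex mat)"
  using assms mat_mult_left_right_inverse[OF assms]
  unfolding invertible_mat_def inverts_mat_def by auto

text \<open>
  The following facts are applied to block matrices. They are isolated because the simplifier expands
  the dimension of a block matrix into a sum over its blocks, which hides that all factors are square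
  of the same size.
\<close>

lemma product_right_inverse:
  fixes U V N :: "complex mat"
  assumes c: "U \<in> carrier_mat m m" "V \<in> carrier_mat m m" "N \<in> carrier_mat m m"
    "Ui \<in> carrier_mat m m" "Vi \<in> carrier_mat m m" "Ni \<in> carrier_mat m m"
    and inv: "U * Ui = 1\<^sub>m m" "V * Vi = 1\<^sub>m m" "N * Ni = 1\<^sub>m m"
  shows "V * N * U * (Ui * Ni * Vi) = 1\<^sub>m m"
  using c inv by (simp add: mat_alg cancel_left_dim[OF inv(1)] cancel_left_dim[OF inv(3)])

lemma product_rotate:
  fixes U V N D :: "complex mat"
  assumes c: "U \<in> carrier_mat m m" "V \<in> carrier_mat m m" "N \<in> carrier_mat m m" "D \<in> carrier_mat m m"
    and one: "V * N * U * D = 1\<^sub>m m"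
  shows "N * (U * (D * V)) = 1\<^sub>m m"
proof -
  have "V * (N * (U * D)) = 1\<^sub>m m" using one c by (simp add: mult_assoc_dim)
  then have "N * (U * D) * V = 1\<^sub>m m"
    by (rule mat_mult_left_right_inverse[rotated 2]) (use c in auto)
  then show ?thesis using c by (simp add: mult_assoc_dim)
qed

text \<open>
  For square matrices \<open>U R N = 1\<close> gives \<open>R N U = 1\<close>, so that \<open>D = (D R) (N U)\<close>.
\<close>

lemma annihilated_is_zero:
  fixes U R N D :: "complex mat"
  assumes c: "U \<in> carrier_mat m m" "R \<in> carrier_mat m m" "N \<in> carrier_mat m m" "D \<in> carrier_mat m m"
    and one: "U * R * N = 1\<^sub>m m" and zero: "D * R = 0\<^sub>m m m"
  shows "D = 0\<^sub>m m m"
proof -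
  have "U * (R * N) = 1\<^sub>m m" using one c by (simp add: mult_assoc_dim)
  then have "R * N * U = 1\<^sub>m m"
    by (rule mat_mult_left_right_inverse[rotated 2]) (use c in auto)
  then have "D = D * (R * (N * U))" using c by (simp add: mult_assoc_dim mult_one_dim)
  also have "\<dots> = (D * R) * (N * U)" using c by (simp add: mult_assoc_dim)
  finally show ?thesis using c zero by (simp add: mat_alg)
qed

section \<open>Block matrices\<close>

lemma mult_block_dim:
  fixes A1 :: "complex mat"
  assumes "dim_row B1 = dim_row A1" "dim_col C1 = dim_col A1" "dim_row D1 = dim_row C1"
    "dim_col D1 = dim_col B1" "dim_row A2 = dim_col A1" "dim_row B2 = dim_col A1"
    "dim_row C2 = dim_col B1" "dim_row D2 = dim_col B1" "dim_col C2 = dim_col A2"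
    "dim_col D2 = dim_col B2"
  shows "four_block_mat A1 B1 C1 D1 * four_block_mat A2 B2 C2 D2
    = four_block_mat (A1 * A2 + B1 * C2) (A1 * B2 + B1 * D2) (C1 * A2 + D1 * C2) (C1 * B2 + D1 * D2)"
  by (rule mult_four_block_mat[of _ "dim_row A1" "dim_col A1" _ "dim_col B1" _ "dim_row C1"
        _ _ "dim_col A2" _ "dim_col B2"])
    (use assms in \<open>auto intro!: carrier_matI\<close>)

lemma four_block_inject:
  fixes A1 :: "complex mat"
  assumes eq: "four_block_mat A1 B1 C1 D1 = four_block_mat A2 B2 C2 D2"
    and "A1 \<in> carrier_mat a c" "B1 \<in> carrier_mat a d" "C1 \<in> carrier_mat b c" "D1 \<in> carrier_mat b d"
    and "A2 \<in> carrier_mat a c" "B2 \<in> carrier_mat a d" "C2 \<in> carrier_mat b c" "D2 \<in> carrier_mat b d"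
  shows "A1 = A2 \<and> B1 = B2 \<and> C1 = C2 \<and> D1 = D2"
proof -
  have ent: "four_block_mat A1 B1 C1 D1 $$ (i, j) = four_block_mat A2 B2 C2 D2 $$ (i, j)" for i j
    using eq by simp
  show ?thesis
  proof (intro conjI)
    show "A1 = A2"
    proof (rule eq_matI)
      fix i j assume "i < dim_row A2" "j < dim_col A2"
      then show "A1 $$ (i, j) = A2 $$ (i, j)" using assms(2-) ent[of i j] by (auto simp: trans_less_add1)
    qed (use assms in auto)
    show "B1 = B2"
    proof (rule eq_matI)
      fix i j assume "i < dim_row B2" "j < dim_col B2"
      then show "B1 $$ (i, j) = B2 $$ (i, j)" using assms(2-) ent[of i "c + j"] by auto
    qed (use assms in auto)
    show "C1 = C2"
    proof (rule eq_matI)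
      fix i j assume "i < dim_row C2" "j < dim_col C2"
      then show "C1 $$ (i, j) = C2 $$ (i, j)" using assms(2-) ent[of "a + i" j] by auto
    qed (use assms in auto)
    show "D1 = D2"
    proof (rule eq_matI)
      fix i j assume "i < dim_row D2" "j < dim_col D2"
      then show "D1 $$ (i, j) = D2 $$ (i, j)" using assms(2-) ent[of "a + i" "c + j"] by auto
    qed (use assms in auto)
  qed
qed

lemma four_block_exists:
  assumes "W \<in> carrier_mat (r1 + r2) (c1 + c2)"
  obtains a b c d where "a \<in> carrier_mat r1 c1" "b \<in> carrier_mat r1 c2"
    "c \<in> carrier_mat r2 c1" "d \<in> carrier_mat r2 c2" "W = four_block_mat a b c d"
proof -
  obtain a b c d where sp: "split_block W r1 c1 = (a, b, c, d)"
    by (cases "split_block W r1 c1") auto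
  show thesis
    using split_block[OF sp, of r2 c2] assms that by auto
qed

lemma append_cols_mult_rows:
  assumes "dim_row C = dim_row B" "dim_row D = dim_col B" "dim_row E = dim_col C" "dim_col E = dim_col D"
  shows "(B @\<^sub>c C) * (D @\<^sub>r E) = B * D + C * E"
proof -
  have "(B @\<^sub>c C) * (D @\<^sub>r E) = four_block_mat (B * D + C * E) (0\<^sub>m (dim_row B) 0)
      (0\<^sub>m 0 (dim_col D)) (0\<^sub>m 0 0)"
    unfolding append_cols_def append_rows_def
    by (subst mult_block_dim) (use assms in \<open>auto simp: mat_alg\<close>)
  also have "\<dots> = B * D + C * E"
    by (rule eq_matI) (use assms in auto)
  finally show ?thesis .
qed

lemma append_cols_mult_block:
  assumes "dim_row C = dim_row B" "dim_row P = dim_col B" "dim_row R = dim_col B"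
    "dim_row S = dim_col C" "dim_row T = dim_col C" "dim_col S = dim_col P" "dim_col T = dim_col R"
  shows "(B @\<^sub>c C) * four_block_mat P R S T = (B * P + C * S) @\<^sub>c (B * R + C * T)"
  unfolding append_cols_def
  by (subst mult_block_dim) (use assms in \<open>auto simp: mat_alg\<close>)

lemma append_cols_append_rows:
  assumes "dim_row C = dim_row B" "dim_col D = dim_col B" "dim_row E = dim_row D" "dim_col E = dim_col C"
  shows "(B @\<^sub>c C) @\<^sub>r (D @\<^sub>c E) = four_block_mat B C D E"
  unfolding append_cols_def append_rows_def
  by (rule eq_matI) (use assms in auto)

lemma mult_append_cols:
  assumes "dim_col P = dim_row B" "dim_row C = dim_row B"
  shows "P * (B @\<^sub>c C) = (P * B) @\<^sub>c (P * C)"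
  unfolding append_cols_def
  by (rule eq_matI) (use assms in \<open>auto simp: scalar_prod_def\<close>)

lemma add_append_cols:
  assumes "dim_row C = dim_row B" "dim_row D = dim_row B" "dim_row E = dim_row B"
    "dim_col D = dim_col B" "dim_col E = dim_col C"
  shows "(B @\<^sub>c C) + (D @\<^sub>c E) = (B + D) @\<^sub>c (C + E)"
  unfolding append_cols_def
  by (rule eq_matI) (use assms in auto)

lemma smult_append_cols:
  assumes "dim_row C = dim_row B"
  shows "a \<cdot>\<^sub>m (B @\<^sub>c C) = (a \<cdot>\<^sub>m B) @\<^sub>c (a \<cdot>\<^sub>m C)"
  unfolding append_cols_def
  by (rule eq_matI) (use assms in auto)

lemma append_cols_eq_zero:
  assumes eq: "B @\<^sub>c C = 0\<^sub>m n m" and c: "B \<in> carrier_mat n p" "C \<in> carrier_mat n q"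
  shows "B = 0\<^sub>m n p" "C = 0\<^sub>m n q"
proof -
  have "m = p + q" using arg_cong[OF eq, of dim_col] c by (simp add: append_cols_def)
  then have "four_block_mat B C (0\<^sub>m 0 p) (0\<^sub>m 0 q)
      = four_block_mat (0\<^sub>m n p) (0\<^sub>m n q) (0\<^sub>m 0 p) (0\<^sub>m 0 q)"
    using eq c by (simp add: append_cols_def)
  from four_block_inject[OF this c, where b = 0] show "B = 0\<^sub>m n p" "C = 0\<^sub>m n q"
    by auto
qed

section \<open>Transpose and conjugate transpose\<close>

lemma adjoint_entry:
  "i < dim_col B \<Longrightarrow> j < dim_row B \<Longrightarrow> mat_adjoint B $$ (i, j) = cnj (B $$ (j, i))" for B :: "complex mat"
  by (simp add: mat_adjoint_def mat_of_rows_def)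

lemma adjoint_dim: "dim_row (mat_adjoint B) = dim_col B" "dim_col (mat_adjoint B) = dim_row B"
  for B :: "complex mat"
  by (simp_all add: mat_adjoint_def)

text \<open>
  Both operations are additive involutions which reverse products and commute with real scalars; this
  is what allows a common treatment. The image of a matrix is called its adjoint in either case.
\<close>

locale matrix_star =
  fixes st :: "complex mat \<Rightarrow> complex mat" and eps :: complex
  assumes star: "st \<in> {mat_adjoint, transpose_mat}" and sign: "eps \<in> {1, - 1}"
begin

lemma star_dim [simp]: "dim_row (st B) = dim_col B" "dim_col (st B) = dim_row B"
  using star by (auto simp: adjoint_dim)

lemma star_mult: "dim_col B = dim_row C \<Longrightarrow> st (B * C) = st C * st B"
  using star by (auto simp: adjoint_entry adjoint_dim scalar_prod_def mult.commute intro!: eq_matI sum.cong)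

lemma star_add: "dim_row B = dim_row C \<Longrightarrow> dim_col B = dim_col C \<Longrightarrow> st (B + C) = st B + st C"
  using star by (auto simp: adjoint_entry adjoint_dim intro!: eq_matI)

lemma star_star [simp]: "st (st B) = B"
  using star by (auto simp: adjoint_entry adjoint_dim intro!: eq_matI)

lemma star_eps: "st (eps \<cdot>\<^sub>m B) = eps \<cdot>\<^sub>m st B" "st ((- eps) \<cdot>\<^sub>m B) = (- eps) \<cdot>\<^sub>m st B"
  using star sign by (auto simp: adjoint_entry adjoint_dim intro!: eq_matI)

lemma star_minus_one: "st ((- 1) \<cdot>\<^sub>m B) = (- 1) \<cdot>\<^sub>m st B"
  using star by (auto simp: adjoint_entry adjoint_dim intro!: eq_matI)

lemma star_one [simp]: "st (1\<^sub>m n) = 1\<^sub>m n"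
  using star by (auto simp: adjoint_entry adjoint_dim intro!: eq_matI)

lemma star_zero [simp]: "st (0\<^sub>m m n) = 0\<^sub>m n m"
  using star by (auto simp: adjoint_entry adjoint_dim intro!: eq_matI)

lemma eps_square [simp]: "eps * eps = 1" "eps * (eps * x) = x"
  using sign by auto

lemma star_entry_closed:
  assumes "K \<in> {\<real>, UNIV}" "i < dim_col B" "j < dim_row B" "B $$ (j, i) \<in> K"
  shows "st B $$ (i, j) \<in> K"
  using star assms by (auto simp: adjoint_entry Reals_cnj_iff)

end

section \<open>Matrices over a subfield\<close>

lemma mats_iff: "B \<in> mats K m n \<longleftrightarrow> B \<in> carrier_mat m n \<and> (\<forall>i<m. \<forall>j<n. B $$ (i, j) \<in> K)"
  by (fastforce simp: mats_def elements_mat_def)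

lemma mats_mult:
  assumes K: "K \<in> {\<real>, UNIV}" and B: "B \<in> mats K m k" and C: "C \<in> mats K k n"
  shows "B * C \<in> mats K m n"
  using assms by (auto simp: mats_iff scalar_prod_def intro!: sum_in_Reals Reals_mult)

lemma mats_add:
  assumes K: "K \<in> {\<real>, UNIV}" and B: "B \<in> mats K m n" and C: "C \<in> mats K m n"
  shows "B + C \<in> mats K m n" "B - C \<in> mats K m n"
  using assms by (auto simp: mats_iff)

lemma (in matrix_star) mats_star:
  assumes K: "K \<in> {\<real>, UNIV}" and B: "B \<in> mats K m n"
  shows "st B \<in> mats K n m"
  using assms star_entry_closed[OF K] by (auto simp: mats_iff)

text \<open>
  For a real matrix the entrywise complex conjugate of the inverse is again an inverse, so the inverse
  is fixed by conjugation.
\<close>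

lemma mats_minv:
  assumes K: "K \<in> {\<real>, UNIV}" and B: "B \<in> mats K n n" and inv: "invertible_mat B"
  shows "minv B \<in> mats K n n"
proof (cases "K = UNIV")
  case True
  then show ?thesis using minv(3)[of B n] assms by (auto simp: mats_iff)
next
  case False
  with K have K: "K = \<real>" by auto
  have Bc: "B \<in> carrier_mat n n" using B by (simp add: mats_iff)
  note m = minv[OF Bc inv]
  let ?c = "map_mat cnj"
  have "?c B = B"
    using B K by (intro eq_matI) (auto simp: mats_iff Reals_cnj_iff)
  moreover have hom: "?c (C * D) = ?c C * ?c D" if "dim_col C = dim_row D" for C D
    using that by (intro eq_matI) (auto simp: scalar_prod_def)
  have "?c (minv B * B) = ?c (minv B) * ?c B"
    using m(3) Bc by (intro hom) auto
  moreover have "?c (1\<^sub>m n) = 1\<^sub>m n"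
    by (intro eq_matI) auto
  ultimately have "?c (minv B) * B = 1\<^sub>m n" using m by simp
  from inverse_unique[OF Bc m(3) _ m(1) this] m(3) have "minv B = ?c (minv B)" by auto
  then have "minv B $$ (i, j) \<in> \<real>" if "i < n" "j < n" for i j
    using that m(3) by (metis Reals_cnj_iff carrier_matD index_map_mat(1))
  then show ?thesis using m(3) K by (auto simp: mats_iff)
qed

section \<open>The homogeneous Sylvester equation\<close>

text \<open>
  After a Schur decomposition \<open>B = R T S\<close> with \<open>S = R\<^sup>-\<^sup>1\<close>, the matrix \<open>M = H R\<close> satisfies \<open>M T = C M\<close>.
  Since \<open>T\<close> is upper triangular, the first nonzero column of \<open>M\<close> would be an eigenvector of \<open>C\<close> for a
  diagonal entry of \<open>T\<close>, that is, for an eigenvalue of \<open>B\<close>.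
\<close>

lemma sylvester_unique:
  fixes B C H :: "complex mat"
  assumes B: "B \<in> carrier_mat p p" and C: "C \<in> carrier_mat q q" and H: "H \<in> carrier_mat q p"
    and eq: "H * B = C * H" and disj: "spectrum B \<inter> spectrum C = {}"
  shows "H = 0\<^sub>m q p"
proof -
  obtain as where as: "char_poly B = (\<Prod>a\<leftarrow>as. [:- a, 1:])"
    using char_poly_factorized[OF B] by blast
  obtain T where T: "T \<in> carrier_mat p p" "upper_triangular T" and sim: "similar_mat B T"
    using schur_decomposition_exists[OF B as] by blast
  from sim obtain R S where w: "similar_mat_wit B T R S" unfolding similar_mat_def by blast
  note w = similar_mat_witD2[OF B w]
  have diag: "T $$ (j, j) \<in> spectrum B" if "j < p" for j
  proof -
    have "char_poly T = (\<Prod>a\<leftarrow>diag_mat T. [:- a, 1:])"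
      by (rule char_poly_upper_triangular[OF T])
    then have cp: "char_poly B = (\<Prod>a\<leftarrow>diag_mat T. [:- a, 1:])"
      using char_poly_similar[OF sim] by simp
    have "T $$ (j, j) \<in> set (diag_mat T)"
      using that T by (auto simp: diag_mat_def)
    then have "poly (char_poly B) (T $$ (j, j)) = 0"
      unfolding cp by (rule linear_poly_root)
    then show ?thesis
      unfolding spectrum_def using eigenvalue_root_char_poly[OF B] by auto
  qed
  define M where "M = H * R"
  have Mc: "M \<in> carrier_mat q p" using H w by (auto simp: M_def)
  have "M * T = H * (R * T * S) * R"
    using H w T by (simp add: M_def mat_alg)
  also have "\<dots> = C * M"
    using H w T B C eq by (simp add: M_def mat_alg flip: w(3))
  finally have MT: "M * T = C * M" .
  have col0: "col M j = 0\<^sub>v q" if "j < p" for j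
    using that
  proof (induction j rule: less_induct)
    case (less j)
    have z: "M $$ (i, k) = 0" if "k < j" "i < q" for i k
      using less.IH[OF that(1)] less.prems that Mc
      by (metis carrier_matD index_col index_zero_vec(1) order.strict_trans)
    have "C *\<^sub>v col M j = col (C * M) j"
      using C Mc less.prems by (intro eq_vecI) auto
    also have "\<dots> = T $$ (j, j) \<cdot>\<^sub>v col M j"
    proof (rule eq_vecI)
      fix i assume "i < dim_vec (T $$ (j, j) \<cdot>\<^sub>v col M j)"
      then have i: "i < q" using Mc by simp
      have "(M * T) $$ (i, j) = (\<Sum>k = 0..<p. M $$ (i, k) * T $$ (k, j))"
        using Mc T less.prems i by (auto simp: scalar_prod_def)
      also have "\<dots> = (\<Sum>k = 0..<p. if k = j then M $$ (i, j) * T $$ (j, j) else 0)"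
      proof (rule sum.cong)
        fix k assume k: "k \<in> {0..<p}"
        show "M $$ (i, k) * T $$ (k, j) = (if k = j then M $$ (i, j) * T $$ (j, j) else 0)"
        proof (cases k j rule: linorder_cases)
          case less
          then show ?thesis using z[of k i] i by simp
        next
          case greater
          then show ?thesis using T k by (auto dest: upper_triangularD)
        qed simp
      qed simp
      also have "\<dots> = M $$ (i, j) * T $$ (j, j)"
        using less.prems by simp
      finally show "col (C * M) j $ i = (T $$ (j, j) \<cdot>\<^sub>v col M j) $ i"
        using MT Mc C T i less.prems by (simp add: mult.commute)
    qed (use C Mc in auto)
    finally have ev: "C *\<^sub>v col M j = T $$ (j, j) \<cdot>\<^sub>v col M j" .
    show ?case
    proof (rule ccontr)
      assume "col M j \<noteq> 0\<^sub>v q"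
      then have "eigenvector C (col M j) (T $$ (j, j))"
        unfolding eigenvector_def using ev C Mc less.prems by auto
      then have "T $$ (j, j) \<in> spectrum C"
        unfolding spectrum_def eigenvalue_def by auto
      then show False using diag[OF less.prems] disj by auto
    qed
  qed
  have "M = 0\<^sub>m q p"
  proof (rule eq_matI)
    fix i j assume "i < dim_row (0\<^sub>m q p)" "j < dim_col (0\<^sub>m q p)"
    then show "M $$ (i, j) = 0\<^sub>m q p $$ (i, j)"
      using arg_cong[OF col0[of j], of "\<lambda>v. v $ i"] Mc by auto
  qed (use Mc in auto)
  then have "H * R * S = 0\<^sub>m q p" using w T by (simp add: M_def mat_alg)
  then show ?thesis using H w by (simp add: mat_alg)
qed

section \<open>The Gram matrix of a standard pair\<close>

context matrix_star
begin

text \<open>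
  Throughout, \<open>N\<close> denotes the inverse of the eigenvalue matrix \<open>L\<close>. Dividing the quadratic equation by
  \<open>L\<close> gives a form in which the outer terms contain \<open>L\<close> and \<open>N\<close>, so that its adjoint contains the
  matrix \<open>N\<^sup>\<star>\<close> that occurs in the Gram matrix.
\<close>

lemma divided_equation:
  assumes c: "A \<in> carrier_mat n n" "Q \<in> carrier_mat n n" "Y \<in> carrier_mat n k" "L \<in> carrier_mat k k"
    "N \<in> carrier_mat k k"
    and LN: "L * N = 1\<^sub>m k"
    and eq: "A * Y * (L * L) + Q * Y * L + eps \<cdot>\<^sub>m (st A * Y) = 0\<^sub>m n k"
  shows "A * (Y * L) + Q * Y + eps \<cdot>\<^sub>m (st A * (Y * N)) = 0\<^sub>m n k"
  using arg_cong[OF eq, of "\<lambda>B. B * N"] c by (simp add: mat_alg LN)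

lemma starred_equation:
  assumes c: "A \<in> carrier_mat n n" "Q \<in> carrier_mat n n" "Y \<in> carrier_mat n k" "L \<in> carrier_mat k k"
    "N \<in> carrier_mat k k"
    and LN: "L * N = 1\<^sub>m k" and Q: "st Q = eps \<cdot>\<^sub>m Q"
    and eq: "A * Y * (L * L) + Q * Y * L + eps \<cdot>\<^sub>m (st A * Y) = 0\<^sub>m n k"
  shows "st L * (st Y * st A) + eps \<cdot>\<^sub>m (st Y * Q) + eps \<cdot>\<^sub>m (st N * (st Y * A)) = 0\<^sub>m k n"
  using arg_cong[OF divided_equation[OF c LN eq], of st] c
  by (simp add: mat_alg star_add star_mult star_eps Q)

text \<open>
  The block, with row data \<open>(Y, N)\<close> and column data \<open>(Z, L)\<close>, of the Gram matrix \<open>V B U\<close>: it is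
  \<open>[Y\<^sup>\<star>, N\<^sup>\<star> Y\<^sup>\<star>]\<close> times the linearisation times the column of \<open>Z\<close> and \<open>Z L\<close>. Here \<open>N\<close> is the inverse of
  the eigenvalue matrix that belongs to \<open>Y\<close>.
\<close>

definition gram :: "complex mat \<Rightarrow> complex mat \<Rightarrow> complex mat \<Rightarrow> complex mat \<Rightarrow> complex mat
    \<Rightarrow> complex mat \<Rightarrow> complex mat" where
  "gram A Q Y N Z L = st Y * (Q * Z) + st N * (st Y * (A * Z)) + st Y * (A * (Z * L))"

text \<open>
  The quadratic equation of \<open>Z\<close> turns the left side into \<open>- \<epsilon> Y\<^sup>\<star> A\<^sup>\<star> Z\<close> plus a term common to both sides;
  the adjoint of the divided equation of \<open>Y\<close> does the same for the right side.
\<close>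

lemma gram_intertwines:
  assumes c: "A \<in> carrier_mat n n" "Q \<in> carrier_mat n n" "Y \<in> carrier_mat n k" "L \<in> carrier_mat k k"
    "N \<in> carrier_mat k k" "Z \<in> carrier_mat n l" "M \<in> carrier_mat l l"
    and LN: "L * N = 1\<^sub>m k" and Q: "st Q = eps \<cdot>\<^sub>m Q"
    and eqY: "A * Y * (L * L) + Q * Y * L + eps \<cdot>\<^sub>m (st A * Y) = 0\<^sub>m n k"
    and eqZ: "A * Z * (M * M) + Q * Z * M + eps \<cdot>\<^sub>m (st A * Z) = 0\<^sub>m n l"
  shows "gram A Q Y N Z M * M = st N * gram A Q Y N Z M"
proof -
  have NL: "st N * st L = 1\<^sub>m k"
    using arg_cong[OF LN, of st] c by (simp add: star_mult)
  have e1: "st Y * (A * (Z * (M * M))) + st Y * (Q * (Z * M)) + eps \<cdot>\<^sub>m (st Y * (st A * Z)) = 0\<^sub>m k l"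
    using arg_cong[OF eqZ, of "\<lambda>B. st Y * B"] c by (simp add: mat_alg)
  have e2: "st Y * (st A * Z) + eps \<cdot>\<^sub>m (st N * (st Y * (Q * Z)))
      + eps \<cdot>\<^sub>m (st N * (st N * (st Y * (A * Z)))) = 0\<^sub>m k l"
    using arg_cong[OF starred_equation[OF c(1-5) LN Q eqY], of "\<lambda>B. st N * (B * Z)"] c
    by (simp add: mat_alg cancel_left_dim[OF NL])
  show ?thesis
  proof (rule eq_matI)
    fix i j assume "i < dim_row (st N * gram A Q Y N Z M)" "j < dim_col (st N * gram A Q Y N Z M)"
    then have ij: "i < k" "j < l" using c by (auto simp: gram_def)
    have "b + f + a = d + e + f" if z: "a + b + eps * x = 0" "x + eps * d + eps * e = 0" for a b d e f x
    proof -
      have "b + f + a - (d + e + f)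
        = (a + b + eps * x) - eps * (x + eps * d + eps * e) + (eps * eps - 1) * (d + e)"
        by (simp only: algebra_simps) simp
      then have "b + f + a - (d + e + f) = 0" unfolding z eps_square(1) by simp
      then show ?thesis by (rule eq_iff_diff_eq_0[THEN iffD2])
    qed
    note key = this
    have "(gram A Q Y N Z M * M) $$ (i, j)
      = (st Y * (Q * (Z * M))) $$ (i, j) + (st N * (st Y * (A * (Z * M)))) $$ (i, j)
        + (st Y * (A * (Z * (M * M)))) $$ (i, j)"
      using c ij by (simp add: gram_def mat_alg del: index_mult_mat(1))
    also have "\<dots> = (st N * (st Y * (Q * Z))) $$ (i, j) + (st N * (st N * (st Y * (A * Z)))) $$ (i, j)
        + (st N * (st Y * (A * (Z * M)))) $$ (i, j)"
      by (rule key)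
        (use arg_cong[OF e1, of "\<lambda>B. B $$ (i, j)"] arg_cong[OF e2, of "\<lambda>B. B $$ (i, j)"] c ij
          in \<open>simp_all del: index_mult_mat(1)\<close>)
    also have "\<dots> = (st N * gram A Q Y N Z M) $$ (i, j)"
      using c ij by (simp add: gram_def mat_alg del: index_mult_mat(1))
    finally show "(gram A Q Y N Z M * M) $$ (i, j) = (st N * gram A Q Y N Z M) $$ (i, j)" .
  qed (use c in \<open>auto simp: gram_def\<close>)
qed

text \<open>
  The adjoint contains \<open>A\<^sup>\<star>\<close> in two terms. The divided equation of \<open>Y\<close> and the adjoint of the one of
  \<open>Z\<close> remove them; each contributes \<open>- \<epsilon> Z\<^sup>\<star> Q Y\<close>, and one of the two cancels against the adjoint of
  \<open>Y\<^sup>\<star> Q Z\<close>.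
\<close>

lemma gram_star:
  assumes c: "A \<in> carrier_mat n n" "Q \<in> carrier_mat n n" "Y \<in> carrier_mat n k" "L \<in> carrier_mat k k"
    "N \<in> carrier_mat k k" "Z \<in> carrier_mat n l" "M \<in> carrier_mat l l" "O' \<in> carrier_mat l l"
    and LN: "L * N = 1\<^sub>m k" and MO: "M * O' = 1\<^sub>m l" and Q: "st Q = eps \<cdot>\<^sub>m Q"
    and eqY: "A * Y * (L * L) + Q * Y * L + eps \<cdot>\<^sub>m (st A * Y) = 0\<^sub>m n k"
    and eqZ: "A * Z * (M * M) + Q * Z * M + eps \<cdot>\<^sub>m (st A * Z) = 0\<^sub>m n l"
  shows "st (gram A Q Y N Z M) = (- eps) \<cdot>\<^sub>m gram A Q Z O' Y L"
proof -
  have e1: "st Z * (A * (Y * L)) + st Z * (Q * Y) + eps \<cdot>\<^sub>m (st Z * (st A * (Y * N))) = 0\<^sub>m l k"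
    using arg_cong[OF divided_equation[OF c(1-5) LN eqY], of "\<lambda>B. st Z * B"] c by (simp add: mat_alg)
  have e2: "st M * (st Z * (st A * Y)) + eps \<cdot>\<^sub>m (st Z * (Q * Y)) + eps \<cdot>\<^sub>m (st O' * (st Z * (A * Y))) = 0\<^sub>m l k"
    using arg_cong[OF starred_equation[OF c(1,2,6,7,8) MO Q eqZ], of "\<lambda>B. B * Y"] c
    by (simp add: mat_alg)
  show ?thesis
  proof (rule eq_matI)
    fix i j assume "i < dim_row ((- eps) \<cdot>\<^sub>m gram A Q Z O' Y L)"
      "j < dim_col ((- eps) \<cdot>\<^sub>m gram A Q Z O' Y L)"
    then have ij: "i < l" "j < k" using c by (auto simp: gram_def)
    have "eps * g + h + x = - (eps * g) - eps * m - eps * a"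
      if z: "a + g + eps * h = 0" "x + eps * g + eps * m = 0" for a g h m x
    proof -
      have "eps * g + h + x - (- (eps * g) - eps * m - eps * a)
        = eps * (a + g + eps * h) + (x + eps * g + eps * m) - (eps * eps - 1) * h"
        by (simp only: algebra_simps) simp
      then have "eps * g + h + x - (- (eps * g) - eps * m - eps * a) = 0"
        unfolding z eps_square(1) by simp
      then show ?thesis by (rule eq_iff_diff_eq_0[THEN iffD2])
    qed
    note key = this
    have "st (gram A Q Y N Z M) $$ (i, j)
      = eps * (st Z * (Q * Y)) $$ (i, j) + (st Z * (st A * (Y * N))) $$ (i, j)
        + (st M * (st Z * (st A * Y))) $$ (i, j)"
      using c ij by (simp add: gram_def mat_alg star_add star_mult Q del: index_mult_mat(1))
    also have "\<dots> = - (eps * (st Z * (Q * Y)) $$ (i, j)) - eps * (st O' * (st Z * (A * Y))) $$ (i, j)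
        - eps * (st Z * (A * (Y * L))) $$ (i, j)"
      by (rule key)
        (use arg_cong[OF e1, of "\<lambda>B. B $$ (i, j)"] arg_cong[OF e2, of "\<lambda>B. B $$ (i, j)"] c ij
          in \<open>simp_all del: index_mult_mat(1)\<close>)
    also have "\<dots> = ((- eps) \<cdot>\<^sub>m gram A Q Z O' Y L) $$ (i, j)"
      using c ij by (simp add: gram_def mat_alg distrib_left del: index_mult_mat(1))
    finally show "st (gram A Q Y N Z M) $$ (i, j) = ((- eps) \<cdot>\<^sub>m gram A Q Z O' Y L) $$ (i, j)" .
  qed (use c in \<open>auto simp: gram_def\<close>)
qed

text \<open>
  By the quadratic equation \<open>Y = Z L\<close> for a suitable \<open>Z\<close>, because \<open>A\<^sup>\<star>\<close> is invertible. So \<open>L\<close> can be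
  factored out on the right of a left inverse of the stacked matrix.
\<close>

lemma factor_invertible:
  assumes c: "A \<in> carrier_mat n n" "Q \<in> carrier_mat n n" "Y \<in> carrier_mat n k" "L \<in> carrier_mat k k"
    and Ai: "Ai \<in> carrier_mat n n" "A * Ai = 1\<^sub>m n"
    and eq: "A * Y * (L * L) + Q * Y * L + eps \<cdot>\<^sub>m (st A * Y) = 0\<^sub>m n k"
    and ab: "a \<in> carrier_mat k n" "b \<in> carrier_mat k n" "a * Y + b * (Y * L) = 1\<^sub>m k"
  shows "invertible_mat L"
proof -
  have AA: "st Ai * st A = 1\<^sub>m n"
    using arg_cong[OF Ai(2), of st] c Ai(1) by (simp add: star_mult)
  define Z where "Z = (- eps) \<cdot>\<^sub>m (st Ai * (A * (Y * L) + Q * Y))"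
  have Z: "Z \<in> carrier_mat n k" using c Ai by (auto simp: Z_def intro!: carrier_matI)
  have e: "st Ai * (A * (Y * (L * L))) + st Ai * (Q * (Y * L)) + eps \<cdot>\<^sub>m Y = 0\<^sub>m n k"
    using arg_cong[OF eq, of "\<lambda>B. st Ai * B"] c Ai by (simp add: mat_alg cancel_left_dim[OF AA])
  have ZL: "Z * L = Y"
  proof (rule eq_matI)
    fix i j assume "i < dim_row Y" "j < dim_col Y"
    then have ij: "i < n" "j < k" using c by auto
    have "- (eps * x) - eps * y = z" if z: "x + y + eps * z = 0" for x y z
    proof -
      have "- (eps * x) - eps * y - z = - eps * (x + y + eps * z) + (eps * eps - 1) * z"
        by (simp only: algebra_simps) simp
      then have "- (eps * x) - eps * y - z = 0" unfolding z eps_square(1) by simp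
      then show ?thesis by (rule eq_iff_diff_eq_0[THEN iffD2])
    qed
    note key = this
    have "(Z * L) $$ (i, j) = - (eps * (st Ai * (A * (Y * (L * L)))) $$ (i, j))
        - eps * (st Ai * (Q * (Y * L))) $$ (i, j)"
      using c ij Ai(1) by (simp add: Z_def mat_alg del: index_mult_mat(1))
    also have "\<dots> = Y $$ (i, j)"
      by (rule key)
        (use arg_cong[OF e, of "\<lambda>B. B $$ (i, j)"] c ij Ai(1) in \<open>simp del: index_mult_mat(1)\<close>)
    finally show "(Z * L) $$ (i, j) = Y $$ (i, j)" .
  qed (use c Z in auto)
  have "(a * Z + b * Y) * L = 1\<^sub>m k"
    using ab c Z by (simp add: mat_alg ZL)
  then have "L * (a * Z + b * Y) = 1\<^sub>m k"
    by (rule mat_mult_left_right_inverse[rotated 2]) (use ab c Z in auto)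
  then show ?thesis
    by (rule invertible_if_right_inverse[rotated 2]) (use ab c Z in auto)
qed

text \<open>
  Since \<open>J\<close> is block diagonal, the quadratic equation for \<open>(X, J)\<close> splits into one for each block.
\<close>

lemma standard_pair_blocks:
  assumes sp: "standard_pair K n st eps A Q (Y1 @\<^sub>c Y2) (diag_block_mat [L1, L2])"
    and A: "A \<in> carrier_mat n n" "Q \<in> carrier_mat n n"
    and c1: "Y1 \<in> carrier_mat n p" "L1 \<in> carrier_mat p p"
    and c2: "Y2 \<in> carrier_mat n q" "L2 \<in> carrier_mat q q"
  shows "A * Y1 * (L1 * L1) + Q * Y1 * L1 + eps \<cdot>\<^sub>m (st A * Y1) = 0\<^sub>m n p"
    and "A * Y2 * (L2 * L2) + Q * Y2 * L2 + eps \<cdot>\<^sub>m (st A * Y2) = 0\<^sub>m n q"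
    and "invertible_mat (four_block_mat Y1 Y2 (Y1 * L1) (Y2 * L2))"
proof -
  let ?J = "four_block_mat L1 (0\<^sub>m p q) (0\<^sub>m q p) L2"
  have "four_block_mat L2 (0\<^sub>m q 0) (0\<^sub>m 0 q) (0\<^sub>m 0 0) = L2"
    by (rule eq_matI) (use c2 in auto)
  then have J: "diag_block_mat [L1, L2] = ?J"
    using c1 c2 by simp
  have JJ: "?J * ?J = four_block_mat (L1 * L1) (0\<^sub>m p q) (0\<^sub>m q p) (L2 * L2)"
    using c1 c2 by (subst mult_block_dim) (auto simp: mat_alg)
  have right: "(B @\<^sub>c C) * four_block_mat D (0\<^sub>m p q) (0\<^sub>m q p) E = (B * D) @\<^sub>c (C * E)"
    if "B \<in> carrier_mat n p" "C \<in> carrier_mat n q" "D \<in> carrier_mat p p" "E \<in> carrier_mat q q"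
    for B C D E
    using that by (subst append_cols_mult_block) (auto simp: mat_alg)
  have "A * (Y1 @\<^sub>c Y2) * (?J * ?J) + Q * (Y1 @\<^sub>c Y2) * ?J + eps \<cdot>\<^sub>m (st A * (Y1 @\<^sub>c Y2))
      = (A * Y1 * (L1 * L1) + Q * Y1 * L1 + eps \<cdot>\<^sub>m (st A * Y1))
        @\<^sub>c (A * Y2 * (L2 * L2) + Q * Y2 * L2 + eps \<cdot>\<^sub>m (st A * Y2))"
    unfolding JJ using A c1 c2
    by (simp add: mult_append_cols right[OF mult_carrier_mat[OF A(1)] mult_carrier_mat[OF A(1)]]
        right[OF mult_carrier_mat[OF A(2)] mult_carrier_mat[OF A(2)]]
        add_append_cols smult_append_cols)
  then have z: "(A * Y1 * (L1 * L1) + Q * Y1 * L1 + eps \<cdot>\<^sub>m (st A * Y1))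
        @\<^sub>c (A * Y2 * (L2 * L2) + Q * Y2 * L2 + eps \<cdot>\<^sub>m (st A * Y2)) = 0\<^sub>m n (2 * n)"
    using sp J by (simp add: standard_pair_def)
  show "A * Y1 * (L1 * L1) + Q * Y1 * L1 + eps \<cdot>\<^sub>m (st A * Y1) = 0\<^sub>m n p"
    by (rule append_cols_eq_zero(1)[OF z]) (use A c1 c2 in \<open>auto intro!: carrier_matI\<close>)
  show "A * Y2 * (L2 * L2) + Q * Y2 * L2 + eps \<cdot>\<^sub>m (st A * Y2) = 0\<^sub>m n q"
    by (rule append_cols_eq_zero(2)[OF z]) (use A c1 c2 in \<open>auto intro!: carrier_matI\<close>)
  have "(Y1 @\<^sub>c Y2) @\<^sub>r ((Y1 @\<^sub>c Y2) * ?J) = four_block_mat Y1 Y2 (Y1 * L1) (Y2 * L2)"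
    using right[OF c1(1) c2(1) c1(2) c2(2)] c1 c2 by (simp add: append_cols_append_rows)
  then show "invertible_mat (four_block_mat Y1 Y2 (Y1 * L1) (Y2 * L2))"
    using sp J by (simp add: standard_pair_def)
qed

lemma standard_pair_invertible:
  assumes A: "A \<in> carrier_mat n n" "Q \<in> carrier_mat n n"
    and Ai: "Ai \<in> carrier_mat n n" "A * Ai = 1\<^sub>m n"
    and c1: "Y1 \<in> carrier_mat n p" "L1 \<in> carrier_mat p p"
    and c2: "Y2 \<in> carrier_mat n q" "L2 \<in> carrier_mat q q"
    and pq: "p + q = n + n"
    and eq1: "A * Y1 * (L1 * L1) + Q * Y1 * L1 + eps \<cdot>\<^sub>m (st A * Y1) = 0\<^sub>m n p"
    and eq2: "A * Y2 * (L2 * L2) + Q * Y2 * L2 + eps \<cdot>\<^sub>m (st A * Y2) = 0\<^sub>m n q"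
    and U: "invertible_mat (four_block_mat Y1 Y2 (Y1 * L1) (Y2 * L2))"
  shows "invertible_mat L1" "invertible_mat L2"
proof -
  let ?U = "four_block_mat Y1 Y2 (Y1 * L1) (Y2 * L2)"
  have Uc: "?U \<in> carrier_mat (p + q) (p + q)"
    using c1 c2 pq by (auto intro!: carrier_matI)
  note W = minv[OF Uc U]
  have "minv ?U \<in> carrier_mat (p + q) (n + n)" using W(3) pq by simp
  then obtain a b c d where abcd: "a \<in> carrier_mat p n" "b \<in> carrier_mat p n"
    "c \<in> carrier_mat q n" "d \<in> carrier_mat q n" and Wb: "minv ?U = four_block_mat a b c d"
    by (rule four_block_exists)
  have "four_block_mat (a * Y1 + b * (Y1 * L1)) (a * Y2 + b * (Y2 * L2))
      (c * Y1 + d * (Y1 * L1)) (c * Y2 + d * (Y2 * L2)) = minv ?U * ?U"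
    unfolding Wb by (subst mult_block_dim) (use abcd c1 c2 in auto)
  also have "\<dots> = four_block_mat (1\<^sub>m p) (0\<^sub>m p q) (0\<^sub>m q p) (1\<^sub>m q)"
    using W(2) by simp
  finally have *: "a * Y1 + b * (Y1 * L1) = 1\<^sub>m p \<and> a * Y2 + b * (Y2 * L2) = 0\<^sub>m p q \<and>
      c * Y1 + d * (Y1 * L1) = 0\<^sub>m q p \<and> c * Y2 + d * (Y2 * L2) = 1\<^sub>m q"
    by (rule four_block_inject[of _ _ _ _ _ _ _ _ p p q q])
      (use abcd c1 c2 in \<open>auto intro!: carrier_matI\<close>)
  show "invertible_mat L1"
    by (rule factor_invertible[OF A c1 Ai eq1 abcd(1,2)]) (use * in auto)
  show "invertible_mat L2"
    by (rule factor_invertible[OF A c2 Ai eq2 abcd(3,4)]) (use * in auto)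
qed

section \<open>Moments of a standard pair\<close>

text \<open>
  Both symmetries of a diagonal block of the Gram matrix pass to its inverse; these are the defining
  conditions of the set \<open>\<S>\<close> attached to \<open>L\<close>.
\<close>

lemma inverse_symmetries:
  assumes gF: "g * F = 1\<^sub>m k" and Fg: "F * g = 1\<^sub>m k" and FL: "F * L = st N * F"
    and F: "st F = (- eps) \<cdot>\<^sub>m F"
    and c: "g \<in> carrier_mat k k" "F \<in> carrier_mat k k" "L \<in> carrier_mat k k" "N \<in> carrier_mat k k"
  shows "st g = (- eps) \<cdot>\<^sub>m g \<and> L * g = g * st N"
proof
  have "st g * st F = 1\<^sub>m k"
    using arg_cong[OF Fg, of st] c by (simp add: star_mult)
  then have gF': "((- eps) \<cdot>\<^sub>m st g) * F = 1\<^sub>m k"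
    using c by (simp add: F mat_alg)
  have "g = (- eps) \<cdot>\<^sub>m st g"
    by (rule inverse_unique[OF c(2,1) _ Fg gF']) (use c in auto)
  from arg_cong[OF this, of st] show "st g = (- eps) \<cdot>\<^sub>m g"
    by (simp add: star_eps)
  have "L * g = g * (F * L) * g"
    using c by (simp add: mat_alg cancel_left_dim[OF gF])
  also have "\<dots> = g * st N"
    unfolding FL using c Fg by (simp add: mat_alg)
  finally show "L * g = g * st N" .
qed

text \<open>
  The second block row of \<open>B (U \<Gamma> V) = 1\<close> determines the zeroth and first moments because \<open>A\<close> is
  invertible; the first block row then gives the second moment. The off-diagonal blocks of \<open>U \<Gamma> V\<close> agree because \<open>J \<Gamma> = \<Gamma> J\<^sup>-\<^sup>\<star>\<close>.
\<close>

lemma spectral_sums: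
  assumes A: "A \<in> carrier_mat n n" "Q \<in> carrier_mat n n" "Ai \<in> carrier_mat n n"
    and AA: "A * Ai = 1\<^sub>m n" "Ai * A = 1\<^sub>m n"
    and Q: "st Q = eps \<cdot>\<^sub>m Q"
    and c1: "Y1 \<in> carrier_mat n p" "L1 \<in> carrier_mat p p" "N1 \<in> carrier_mat p p"
    and c2: "Y2 \<in> carrier_mat n q" "L2 \<in> carrier_mat q q" "N2 \<in> carrier_mat q q"
    and pq: "p + q = n + n"
    and LN: "L1 * N1 = 1\<^sub>m p" "L2 * N2 = 1\<^sub>m q"
    and eq1: "A * Y1 * (L1 * L1) + Q * Y1 * L1 + eps \<cdot>\<^sub>m (st A * Y1) = 0\<^sub>m n p"
    and eq2: "A * Y2 * (L2 * L2) + Q * Y2 * L2 + eps \<cdot>\<^sub>m (st A * Y2) = 0\<^sub>m n q"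
    and U: "invertible_mat (four_block_mat Y1 Y2 (Y1 * L1) (Y2 * L2))"
    and disj: "spectrum L1 \<inter> spectrum (st N2) = {}"
  obtains g1 g2 where "g1 \<in> carrier_mat p p" "g2 \<in> carrier_mat q q"
    "gram A Q Y1 N1 Y1 L1 * g1 = 1\<^sub>m p"
    "st g1 = (- eps) \<cdot>\<^sub>m g1" "L1 * g1 = g1 * st N1"
    "st g2 = (- eps) \<cdot>\<^sub>m g2" "L2 * g2 = g2 * st N2"
    "Y1 * (g1 * st Y1) + Y2 * (g2 * st Y2) = 0\<^sub>m n n"
    "Y1 * (L1 * (g1 * st Y1)) + Y2 * (L2 * (g2 * st Y2)) = Ai"
    "Y1 * (L1 * (L1 * (g1 * st Y1))) + Y2 * (L2 * (L2 * (g2 * st Y2))) = (- 1) \<cdot>\<^sub>m (Ai * (Q * Ai))"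
proof -
  have NL: "N1 * L1 = 1\<^sub>m p" "N2 * L2 = 1\<^sub>m q"
    using mat_mult_left_right_inverse LN c1 c2 by blast+
  let ?U = "four_block_mat Y1 Y2 (Y1 * L1) (Y2 * L2)"
  let ?B = "four_block_mat Q A A (0\<^sub>m n n)"
  let ?Bi = "four_block_mat (0\<^sub>m n n) Ai Ai ((- 1) \<cdot>\<^sub>m (Ai * (Q * Ai)))"
  let ?V = "four_block_mat (st Y1) (st N1 * st Y1) (st Y2) (st N2 * st Y2)"
  define F11 where "F11 = gram A Q Y1 N1 Y1 L1"
  define F12 where "F12 = gram A Q Y1 N1 Y2 L2"
  define F21 where "F21 = gram A Q Y2 N2 Y1 L1"
  define F22 where "F22 = gram A Q Y2 N2 Y2 L2"
  have Fc: "F11 \<in> carrier_mat p p" "F12 \<in> carrier_mat p q" "F21 \<in> carrier_mat q p" "F22 \<in> carrier_mat q q"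
    using A c1 c2 by (auto simp: F11_def F12_def F21_def F22_def gram_def intro!: carrier_matI)
  have Uc: "?U \<in> carrier_mat (n + n) (n + n)" and Vc: "?V \<in> carrier_mat (n + n) (n + n)"
    and Nc: "?B \<in> carrier_mat (n + n) (n + n)" and Nic: "?Bi \<in> carrier_mat (n + n) (n + n)"
    using A c1 c2 pq by (auto intro!: carrier_matI)
  \<comment> \<open>An inverse of \<open>U\<close> in blocks.\<close>
  note W = minv[OF Uc U]
  have "minv ?U \<in> carrier_mat (p + q) (n + n)" using W(3) pq by simp
  then obtain a b c d where abcd: "a \<in> carrier_mat p n" "b \<in> carrier_mat p n"
    "c \<in> carrier_mat q n" "d \<in> carrier_mat q n" and Wb: "minv ?U = four_block_mat a b c d"
    by (rule four_block_exists)
  have "four_block_mat (Y1 * a + Y2 * c) (Y1 * b + Y2 * d)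
      (Y1 * (L1 * a) + Y2 * (L2 * c)) (Y1 * (L1 * b) + Y2 * (L2 * d)) = ?U * minv ?U"
    unfolding Wb by (subst mult_block_dim) (use abcd c1 c2 in \<open>auto simp: mat_alg\<close>)
  also have "\<dots> = four_block_mat (1\<^sub>m n) (0\<^sub>m n n) (0\<^sub>m n n) (1\<^sub>m n)"
    using W(1) by simp
  finally have UW: "Y1 * a + Y2 * c = 1\<^sub>m n \<and> Y1 * b + Y2 * d = 0\<^sub>m n n \<and>
      Y1 * (L1 * a) + Y2 * (L2 * c) = 0\<^sub>m n n \<and> Y1 * (L1 * b) + Y2 * (L2 * d) = 1\<^sub>m n"
    by (rule four_block_inject[of _ _ _ _ _ _ _ _ n n n n])
      (use abcd c1 c2 in \<open>auto intro!: carrier_matI\<close>)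
  \<comment> \<open>The adjoint of \<open>V\<close> has block rows \<open>X\<close> and \<open>X J\<^sup>-\<^sup>1\<close>. It is \<open>U\<close> with its block rows exchanged, times
    \<open>J\<^sup>-\<^sup>1\<close>, so a left inverse of \<open>V\<close> can be read off from the blocks of the inverse of \<open>U\<close>.\<close>
  let ?T = "four_block_mat (st (L1 * b)) (st (L2 * d)) (st (L1 * a)) (st (L2 * c))"
  have Tc: "?T \<in> carrier_mat (n + n) (n + n)"
    using abcd c1 c2 pq by (auto intro!: carrier_matI)
  have "?T * ?V = four_block_mat (st (Y1 * (L1 * b) + Y2 * (L2 * d))) (st (Y1 * b + Y2 * d))
      (st (Y1 * (L1 * a) + Y2 * (L2 * c))) (st (Y1 * a + Y2 * c))"
    using arg_cong[OF NL(1), of st] arg_cong[OF NL(2), of st] abcd c1 c2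
    by (subst mult_block_dim)
      (auto simp: mat_alg star_add star_mult cancel_left_dim[of "st L1" "st N1" p]
        cancel_left_dim[of "st L2" "st N2" q])
  then have TV: "?T * ?V = 1\<^sub>m (n + n)" using UW by simp
  have VT: "?V * ?T = 1\<^sub>m (n + n)" by (rule mat_mult_left_right_inverse[OF Tc Vc TV])
  have NNi: "?B * ?Bi = 1\<^sub>m (n + n)"
  proof -
    have "Q * Ai + (- 1) \<cdot>\<^sub>m (Q * Ai) = 0\<^sub>m n n"
      using A by (intro eq_matI) (auto simp del: index_mult_mat(1))
    then have "?B * ?Bi = four_block_mat (1\<^sub>m n) (0\<^sub>m n n) (0\<^sub>m n n) (1\<^sub>m n)"
      using A AA by (subst mult_block_dim) (auto simp: mat_alg cancel_left_dim[OF AA(1)])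
    then show ?thesis by simp
  qed
  \<comment> \<open>The Gram matrix is block diagonal: one off-diagonal block vanishes by the Sylvester equation,
    the other one is its adjoint up to sign.\<close>
  have G: "?V * ?B * ?U = four_block_mat F11 F12 F21 F22"
    unfolding F11_def F12_def F21_def F22_def gram_def using A c1 c2
    by (simp add: mult_block_dim mat_alg)
  have "F21 = 0\<^sub>m q p"
  proof (rule sylvester_unique[OF c1(2) _ Fc(3) _ disj])
    show "F21 * L1 = st N2 * F21" unfolding F21_def
      by (rule gram_intertwines[OF A(1,2) c2 c1(1,2) LN(2) Q eq2 eq1])
  qed (use c2 in auto)
  moreover have "st F21 = (- eps) \<cdot>\<^sub>m F12"
    unfolding F21_def F12_def by (rule gram_star[OF A(1,2) c2 c1 LN(2,1) Q eq2 eq1])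
  ultimately have "(- eps) \<cdot>\<^sub>m ((- eps) \<cdot>\<^sub>m F12) = (- eps) \<cdot>\<^sub>m 0\<^sub>m p q"
    by simp
  then have F12: "F12 = 0\<^sub>m p q" by (simp add: mat_alg)
  let ?Gi = "minv ?U * ?Bi * ?T"
  have Gic: "?Gi \<in> carrier_mat (p + q) (p + q)" using W(3) Nic Tc pq by auto
  have "?V * ?B * ?U * ?Gi = 1\<^sub>m (n + n)"
    by (rule product_right_inverse[OF Uc Vc Nc W(3) Tc Nic W(1) VT NNi])
  then have GGi: "four_block_mat F11 F12 F21 F22 * ?Gi = 1\<^sub>m (p + q)"
    unfolding G pq .
  obtain g1 x y g2 where gc: "g1 \<in> carrier_mat p p" "x \<in> carrier_mat p q"
    "y \<in> carrier_mat q p" "g2 \<in> carrier_mat q q" and Gib: "?Gi = four_block_mat g1 x y g2"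
    using Gic by (rule four_block_exists)
  have "four_block_mat (F11 * g1) (F11 * x) (F22 * y) (F22 * g2) = four_block_mat F11 F12 F21 F22 * ?Gi"
    unfolding Gib using Fc gc F12 \<open>F21 = 0\<^sub>m q p\<close> by (subst mult_block_dim) (auto simp: mat_alg)
  also have "\<dots> = four_block_mat (1\<^sub>m p) (0\<^sub>m p q) (0\<^sub>m q p) (1\<^sub>m q)"
    using GGi by simp
  finally have "F11 * g1 = 1\<^sub>m p \<and> F11 * x = 0\<^sub>m p q \<and> F22 * y = 0\<^sub>m q p \<and> F22 * g2 = 1\<^sub>m q"
    by (rule four_block_inject[of _ _ _ _ _ _ _ _ p p q q]) (use Fc gc in auto)
  then have Fg: "F11 * g1 = 1\<^sub>m p" "F22 * g2 = 1\<^sub>m q" by auto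
  have gF: "g1 * F11 = 1\<^sub>m p" "g2 * F22 = 1\<^sub>m q"
    using mat_mult_left_right_inverse Fg Fc gc by blast+
  have sym1: "st g1 = (- eps) \<cdot>\<^sub>m g1 \<and> L1 * g1 = g1 * st N1"
  proof (rule inverse_symmetries[OF gF(1) Fg(1)])
    show "F11 * L1 = st N1 * F11" unfolding F11_def
      by (rule gram_intertwines[OF A(1,2) c1 c1(1,2) LN(1) Q eq1 eq1])
    show "st F11 = (- eps) \<cdot>\<^sub>m F11" unfolding F11_def
      by (rule gram_star[OF A(1,2) c1 c1 LN(1,1) Q eq1 eq1])
  qed (use c1 Fc gc in auto)
  have sym2: "st g2 = (- eps) \<cdot>\<^sub>m g2 \<and> L2 * g2 = g2 * st N2"
  proof (rule inverse_symmetries[OF gF(2) Fg(2)])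
    show "F22 * L2 = st N2 * F22" unfolding F22_def
      by (rule gram_intertwines[OF A(1,2) c2 c2(1,2) LN(2) Q eq2 eq2])
    show "st F22 = (- eps) \<cdot>\<^sub>m F22" unfolding F22_def
      by (rule gram_star[OF A(1,2) c2 c2 LN(2,2) Q eq2 eq2])
  qed (use c2 Fc gc in auto)
  \<comment> \<open>Square matrices commute with their inverses, so \<open>V\<close> may be moved from the left end of
    \<open>V B U \<Gamma> = 1\<close> to the right end.\<close>
  let ?D = "four_block_mat g1 (0\<^sub>m p q) (0\<^sub>m q p) g2"
  have Dc: "?D \<in> carrier_mat (n + n) (n + n)" using gc pq by (auto intro!: carrier_matI)
  have "?V * ?B * ?U * ?D = 1\<^sub>m (n + n)"
    unfolding G using Fc gc F12 \<open>F21 = 0\<^sub>m q p\<close> Fg pq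
    by (subst mult_block_dim) (auto simp: mat_alg)
  then have NUDV: "?B * (?U * (?D * ?V)) = 1\<^sub>m (n + n)"
    by (rule product_rotate[OF Uc Vc Nc Dc])
  define s0 where "s0 = Y1 * (g1 * st Y1) + Y2 * (g2 * st Y2)"
  define s1 where "s1 = Y1 * (L1 * (g1 * st Y1)) + Y2 * (L2 * (g2 * st Y2))"
  define s2 where "s2 = Y1 * (L1 * (L1 * (g1 * st Y1))) + Y2 * (L2 * (L2 * (g2 * st Y2)))"
  have sc: "s0 \<in> carrier_mat n n" "s1 \<in> carrier_mat n n" "s2 \<in> carrier_mat n n"
    using c1 c2 gc by (auto simp: s0_def s1_def s2_def intro!: carrier_matI)
  have swap: "g1 * (st N1 * X) = L1 * (g1 * X)" if "dim_row X = p" for X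
    using sym1 c1 gc that by (simp flip: mult_assoc_dim)
  have swap2: "g2 * (st N2 * X) = L2 * (g2 * X)" if "dim_row X = q" for X
    using sym2 c2 gc that by (simp flip: mult_assoc_dim)
  have "?U * (?D * ?V) = four_block_mat s0 s1 s1 s2"
    unfolding s0_def s1_def s2_def using c1 c2 gc
    by (simp add: mult_block_dim mat_alg swap swap2)
  with NUDV have "four_block_mat (Q * s0 + A * s1) (Q * s1 + A * s2) (A * s0) (A * s1)
      = four_block_mat (1\<^sub>m n) (0\<^sub>m n n) (0\<^sub>m n n) (1\<^sub>m n)"
    using sc A by (simp add: mult_block_dim mat_alg)
  then have S: "Q * s0 + A * s1 = 1\<^sub>m n \<and> Q * s1 + A * s2 = 0\<^sub>m n n \<and> A * s0 = 0\<^sub>m n n \<and> A * s1 = 1\<^sub>m n"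
    by (rule four_block_inject[of _ _ _ _ _ _ _ _ n n n n]) (use sc A in auto)
  then have S0: "A * s0 = 0\<^sub>m n n" and S1: "A * s1 = 1\<^sub>m n" and S2: "Q * s1 + A * s2 = 0\<^sub>m n n"
    by auto
  have s0: "s0 = 0\<^sub>m n n"
    using arg_cong[OF S0, of "\<lambda>B. Ai * B"] sc A by (simp add: mat_alg cancel_left_dim[OF AA(2)])
  have s1: "s1 = Ai"
    using arg_cong[OF S1, of "\<lambda>B. Ai * B"] sc A by (simp add: mat_alg cancel_left_dim[OF AA(2)])
  have "Ai * (Q * Ai) + s2 = 0\<^sub>m n n"
    using arg_cong[OF S2, of "\<lambda>B. Ai * B"] sc A
    by (simp add: s1 mat_alg cancel_left_dim[OF AA(2)])
  then have s2: "s2 = (- 1) \<cdot>\<^sub>m (Ai * (Q * Ai))"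
  proof (intro eq_matI)
    fix i j assume ij: "i < dim_row ((- 1) \<cdot>\<^sub>m (Ai * (Q * Ai)))" "j < dim_col ((- 1) \<cdot>\<^sub>m (Ai * (Q * Ai)))"
    assume "Ai * (Q * Ai) + s2 = 0\<^sub>m n n"
    from arg_cong[OF this, of "\<lambda>B. B $$ (i, j)"] ij A sc
    show "s2 $$ (i, j) = ((- 1) \<cdot>\<^sub>m (Ai * (Q * Ai))) $$ (i, j)"
      by (simp add: eq_neg_iff_add_eq_0 add.commute del: index_mult_mat(1))
  qed (use A sc in auto)
  show thesis
    by (rule that[OF gc(1,4)]) (use Fg sym1 sym2 s0 s1 s2 in \<open>auto simp: F11_def s0_def s1_def s2_def\<close>)
qed

text \<open>
  Let \<open>D = Qt X + At X J + \<epsilon> At\<^sup>\<star> X J\<^sup>-\<^sup>1\<close> be the residual of the divided equation. Multiplied by \<open>\<Gamma> X\<^sup>\<star>\<close> and by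
  \<open>J \<Gamma> X\<^sup>\<star>\<close>, it becomes a combination of moments, which vanishes by the hypotheses; here the adjoint of the first
  moment is \<open>- \<epsilon>\<close> times the moment with exponent \<open>- 1\<close>. The matrix \<open>R\<close> with block columns \<open>\<Gamma> X\<^sup>\<star>\<close> and
  \<open>J \<Gamma> X\<^sup>\<star>\<close> is invertible, because \<open>U R\<close> consists of the moments and \<open>M\<close> is invertible. So \<open>D = 0\<close>, which
  is the quadratic equation. The symmetry of \<open>Qt\<close> follows by multiplying \<open>D = 0\<close> by \<open>J\<^sup>-\<^sup>1 \<Gamma> X\<^sup>\<star>\<close>
  and using the adjoint of the second moment.
\<close>

lemma inverse_problem:
  assumes M: "M \<in> carrier_mat n n" "At \<in> carrier_mat n n" "Qt \<in> carrier_mat n n"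
    and MA: "M * At = 1\<^sub>m n" "At * M = 1\<^sub>m n"
    and c1: "Y1 \<in> carrier_mat n p" "L1 \<in> carrier_mat p p" "N1 \<in> carrier_mat p p" "g1 \<in> carrier_mat p p"
    and c2: "Y2 \<in> carrier_mat n q" "L2 \<in> carrier_mat q q" "N2 \<in> carrier_mat q q" "g2 \<in> carrier_mat q q"
    and pq: "p + q = n + n"
    and LN: "L1 * N1 = 1\<^sub>m p" "L2 * N2 = 1\<^sub>m q"
    and g1: "st g1 = (- eps) \<cdot>\<^sub>m g1" "L1 * g1 = g1 * st N1"
    and g2: "st g2 = (- eps) \<cdot>\<^sub>m g2" "L2 * g2 = g2 * st N2"
    and s0: "Y1 * (g1 * st Y1) + Y2 * (g2 * st Y2) = 0\<^sub>m n n"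
    and s1: "Y1 * (L1 * (g1 * st Y1)) + Y2 * (L2 * (g2 * st Y2)) = M"
    and s2: "Y1 * (L1 * (L1 * (g1 * st Y1))) + Y2 * (L2 * (L2 * (g2 * st Y2))) = (- 1) \<cdot>\<^sub>m (M * (Qt * M))"
  shows "st Qt = eps \<cdot>\<^sub>m Qt"
    and "At * Y1 * (L1 * L1) + Qt * Y1 * L1 + eps \<cdot>\<^sub>m (st At * Y1) = 0\<^sub>m n p"
    and "At * Y2 * (L2 * L2) + Qt * Y2 * L2 + eps \<cdot>\<^sub>m (st At * Y2) = 0\<^sub>m n q"
proof -
  have NL: "N1 * L1 = 1\<^sub>m p" "N2 * L2 = 1\<^sub>m q"
    using mat_mult_left_right_inverse LN c1 c2 by blast+
  \<comment> \<open>Up to the factor \<open>- \<epsilon>\<close>, the adjoint of a moment is the moment with the opposite exponent.\<close>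
  have flip: "g * (st L * X) = N * (g * X)"
    if "L * g = g * st N" "N * L = 1\<^sub>m k" "dim_row X = k"
      and c: "g \<in> carrier_mat k k" "L \<in> carrier_mat k k" "N \<in> carrier_mat k k" for g L N X k
  proof -
    have NLs: "st N * st L = 1\<^sub>m k"
      using arg_cong[OF mat_mult_left_right_inverse[OF c(3,2) that(2)], of st] c
      by (simp add: star_mult)
    have "N * (g * X) = N * ((g * st N) * (st L * X))"
      using c that(3) by (simp add: mat_alg cancel_left_dim[OF NLs])
    also have "\<dots> = g * (st L * X)"
      unfolding that(1)[symmetric] using c that(3) by (simp add: mat_alg cancel_left_dim[OF that(2)])
    finally show ?thesis by simp
  qed
  note flip1 = flip[OF g1(2) NL(1) _ c1(4,2,3)] and flip2 = flip[OF g2(2) NL(2) _ c2(4,2,3)]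
  have t1: "eps \<cdot>\<^sub>m (Y1 * (N1 * (g1 * st Y1)) + Y2 * (N2 * (g2 * st Y2))) = (- 1) \<cdot>\<^sub>m st M"
    using arg_cong[OF s1, of "\<lambda>B. (- 1) \<cdot>\<^sub>m st B"] c1 c2
    by (simp add: star_add star_mult g1(1) g2(1) mat_alg flip1 flip2)
  have t2: "Y1 * (N1 * (N1 * (g1 * st Y1))) + Y2 * (N2 * (N2 * (g2 * st Y2)))
      = eps \<cdot>\<^sub>m (st M * (st Qt * st M))"
    using arg_cong[OF s2, of "\<lambda>B. (- eps) \<cdot>\<^sub>m st B"] c1 c2 M
    by (simp add: star_add star_mult g1(1) g2(1) mat_alg flip1 flip2 star_minus_one)
  \<comment> \<open>The residual \<open>D\<close> by columns: \<open>d0\<close> and \<open>d1\<close> are its products with the two block columns of \<open>R\<close>.\<close>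
  define D1 where "D1 = Qt * Y1 + At * (Y1 * L1) + eps \<cdot>\<^sub>m (st At * (Y1 * N1))"
  define D2 where "D2 = Qt * Y2 + At * (Y2 * L2) + eps \<cdot>\<^sub>m (st At * (Y2 * N2))"
  have Dc: "D1 \<in> carrier_mat n p" "D2 \<in> carrier_mat n q"
    using M c1 c2 by (auto simp: D1_def D2_def intro!: carrier_matI)
  have regroup: "D1 * u1 + D2 * u2 = Qt * (Y1 * u1 + Y2 * u2)
      + At * (Y1 * (L1 * u1) + Y2 * (L2 * u2)) + st At * (eps \<cdot>\<^sub>m (Y1 * (N1 * u1) + Y2 * (N2 * u2)))"
    if u: "u1 \<in> carrier_mat p n" "u2 \<in> carrier_mat q n" for u1 u2
  proof (rule eq_matI)
    fix i j assume "i < dim_row (Qt * (Y1 * u1 + Y2 * u2)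
      + At * (Y1 * (L1 * u1) + Y2 * (L2 * u2)) + st At * (eps \<cdot>\<^sub>m (Y1 * (N1 * u1) + Y2 * (N2 * u2))))"
      "j < dim_col (Qt * (Y1 * u1 + Y2 * u2)
      + At * (Y1 * (L1 * u1) + Y2 * (L2 * u2)) + st At * (eps \<cdot>\<^sub>m (Y1 * (N1 * u1) + Y2 * (N2 * u2))))"
    then show "(D1 * u1 + D2 * u2) $$ (i, j) = (Qt * (Y1 * u1 + Y2 * u2)
      + At * (Y1 * (L1 * u1) + Y2 * (L2 * u2))
      + st At * (eps \<cdot>\<^sub>m (Y1 * (N1 * u1) + Y2 * (N2 * u2)))) $$ (i, j)"
      using M c1 c2 u by (simp add: D1_def D2_def mat_alg del: index_mult_mat(1))
  qed (use M c1 c2 u in \<open>auto simp: D1_def D2_def\<close>)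
  have MAs: "st At * st M = 1\<^sub>m n" "st M * st At = 1\<^sub>m n"
    using arg_cong[OF MA(1), of st] arg_cong[OF MA(2), of st] M by (simp_all add: star_mult)
  have neg_sum: "B + (- 1) \<cdot>\<^sub>m B = 0\<^sub>m n n" if "B \<in> carrier_mat n n" for B :: "complex mat"
    using that by (intro eq_matI) auto
  have NLX: "N1 * (L1 * X) = X" "L1 * (N1 * X) = X" if "dim_row X = p" for X
    using that cancel_left_dim[OF NL(1)] cancel_left_dim[OF LN(1)] c1 by auto
  have NLX2: "N2 * (L2 * X) = X" "L2 * (N2 * X) = X" if "dim_row X = q" for X
    using that cancel_left_dim[OF NL(2)] cancel_left_dim[OF LN(2)] c2 by auto
  have d0: "D1 * (g1 * st Y1) + D2 * (g2 * st Y2) = 0\<^sub>m n n"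
  proof -
    have "D1 * (g1 * st Y1) + D2 * (g2 * st Y2)
        = Qt * 0\<^sub>m n n + At * M + st At * ((- 1) \<cdot>\<^sub>m st M)"
      by (subst regroup) (use c1 c2 s0 s1 t1 in \<open>auto intro!: carrier_matI\<close>)
    then show ?thesis using M neg_sum[of "1\<^sub>m n"] by (simp add: MA MAs mat_alg)
  qed
  have d1: "D1 * (L1 * (g1 * st Y1)) + D2 * (L2 * (g2 * st Y2)) = 0\<^sub>m n n"
  proof -
    have "D1 * (L1 * (g1 * st Y1)) + D2 * (L2 * (g2 * st Y2))
        = Qt * M + At * ((- 1) \<cdot>\<^sub>m (M * (Qt * M))) + st At * (eps \<cdot>\<^sub>m 0\<^sub>m n n)"
      by (subst regroup) (use c1 c2 s0 s1 s2 in \<open>auto simp: NLX NLX2 intro!: carrier_matI\<close>)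
    then show ?thesis using M neg_sum[of "Qt * M"] by (simp add: cancel_left_dim[OF MA(2)] mat_alg)
  qed
  \<comment> \<open>\<open>D\<close> is padded by zero rows to a square matrix, so that \<open>D R = 0\<close> with \<open>R\<close> invertible gives
    \<open>D = 0\<close>.\<close>
  let ?U = "four_block_mat Y1 Y2 (Y1 * L1) (Y2 * L2)"
  let ?B = "four_block_mat Qt At At (0\<^sub>m n n)"
  let ?R = "four_block_mat (g1 * st Y1) (L1 * (g1 * st Y1)) (g2 * st Y2) (L2 * (g2 * st Y2))"
  let ?D = "four_block_mat D1 D2 (0\<^sub>m n p) (0\<^sub>m n q)"
  have Uc: "?U \<in> carrier_mat (n + n) (n + n)" and Rc: "?R \<in> carrier_mat (n + n) (n + n)"
    and Nc: "?B \<in> carrier_mat (n + n) (n + n)" and Dc': "?D \<in> carrier_mat (n + n) (n + n)"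
    using M c1 c2 pq Dc by (auto intro!: carrier_matI)
  have "?U * ?R = four_block_mat (0\<^sub>m n n) M M ((- 1) \<cdot>\<^sub>m (M * (Qt * M)))"
    using c1 c2 by (subst mult_block_dim) (auto simp: mat_alg s0 s1 s2)
  then have "?U * ?R * ?B = four_block_mat (1\<^sub>m n) (0\<^sub>m n n) (M * Qt + (- 1) \<cdot>\<^sub>m (M * Qt)) (1\<^sub>m n)"
    using M by (simp add: mult_block_dim mat_alg MA)
  then have URN: "?U * ?R * ?B = 1\<^sub>m (n + n)"
    using M by (simp add: neg_sum)
  have DR: "?D * ?R = 0\<^sub>m (n + n) (n + n)"
    using c1 c2 Dc by (subst mult_block_dim) (auto simp: d0 d1 mat_alg)
  have "?D = four_block_mat (0\<^sub>m n p) (0\<^sub>m n q) (0\<^sub>m n p) (0\<^sub>m n q)"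
    using annihilated_is_zero[OF Uc Rc Nc Dc' URN DR] pq by simp
  then have "D1 = 0\<^sub>m n p \<and> D2 = 0\<^sub>m n q \<and> 0\<^sub>m n p = (0\<^sub>m n p :: complex mat) \<and> 0\<^sub>m n q = (0\<^sub>m n q :: complex mat)"
    by (rule four_block_inject) (use Dc in auto)
  then have D: "D1 = 0\<^sub>m n p" "D2 = 0\<^sub>m n q" by auto
  have expand: "At * Y * (L * L) + Qt * Y * L + eps \<cdot>\<^sub>m (st At * Y) = 0\<^sub>m n k"
    if D: "Qt * Y + At * (Y * L) + eps \<cdot>\<^sub>m (st At * (Y * N)) = 0\<^sub>m n k" and NL: "N * L = 1\<^sub>m k"
      and c: "Y \<in> carrier_mat n k" "L \<in> carrier_mat k k" "N \<in> carrier_mat k k" for Y L N k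
  proof -
    have comm: "At * (Y * (L * L)) + Qt * (Y * L) = Qt * (Y * L) + At * (Y * (L * L))"
      by (rule comm_add_mat[of _ n k]) (use M c in auto)
    show ?thesis
      using arg_cong[OF D, of "\<lambda>B. B * L"] M c by (simp add: mat_alg NL comm)
  qed
  show "At * Y1 * (L1 * L1) + Qt * Y1 * L1 + eps \<cdot>\<^sub>m (st At * Y1) = 0\<^sub>m n p"
    using D(1) NL(1) c1(1-3) unfolding D1_def by (rule expand)
  show "At * Y2 * (L2 * L2) + Qt * Y2 * L2 + eps \<cdot>\<^sub>m (st At * Y2) = 0\<^sub>m n q"
    using D(2) NL(2) c2(1-3) unfolding D2_def by (rule expand)
  \<comment> \<open>Multiplying \<open>D = 0\<close> by \<open>J\<^sup>-\<^sup>1 \<Gamma> X\<^sup>\<star>\<close> compares \<open>Qt\<close> with its adjoint.\<close>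
  have Ntil: "Y1 * (N1 * (g1 * st Y1)) + Y2 * (N2 * (g2 * st Y2)) = (- eps) \<cdot>\<^sub>m st M"
    using arg_cong[OF t1, of "\<lambda>B. eps \<cdot>\<^sub>m B"] c1 c2 by (simp add: mat_alg)
  have "Qt * ((- eps) \<cdot>\<^sub>m st M) + At * 0\<^sub>m n n
      + st At * (eps \<cdot>\<^sub>m (eps \<cdot>\<^sub>m (st M * (st Qt * st M))))
      = D1 * (N1 * (g1 * st Y1)) + D2 * (N2 * (g2 * st Y2))"
    by (subst regroup) (use c1 c2 s0 Ntil t2 in \<open>auto simp: NLX NLX2 intro!: carrier_matI\<close>)
  also have "\<dots> = 0\<^sub>m n n"
    unfolding D using c1 c2 by (simp add: mat_alg)
  finally have "(- eps) \<cdot>\<^sub>m (Qt * st M) + st Qt * st M = 0\<^sub>m n n"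
    using M by (simp add: mat_alg cancel_left_dim[OF MAs(1)])
  from arg_cong[OF this, of "\<lambda>B. B * st At"]
  have z: "(- eps) \<cdot>\<^sub>m Qt + st Qt = 0\<^sub>m n n"
    using M by (simp add: mat_alg MAs)
  show "st Qt = eps \<cdot>\<^sub>m Qt"
  proof (rule eq_matI)
    fix i j assume "i < dim_row (eps \<cdot>\<^sub>m Qt)" "j < dim_col (eps \<cdot>\<^sub>m Qt)"
    then show "st Qt $$ (i, j) = (eps \<cdot>\<^sub>m Qt) $$ (i, j)"
      using arg_cong[OF z, of "\<lambda>B. B $$ (i, j)"] M by simp
  qed (use M in auto)
qed

end

section \<open>Updating without spill-over\<close>

theorem theorem4p2:
  fixes K :: "complex set" and st :: "complex mat \<Rightarrow> complex mat" and eps :: complex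
    and n p :: nat and A Q X J Y1 Y2 L1 L2 Lt1 G1 Gamma1 :: "complex mat"
    and lt :: "nat \<Rightarrow> complex"
  assumes K: "K \<in> {\<real>, UNIV}"
    and st: "st \<in> {mat_adjoint, transpose_mat}"
    and eps: "eps \<in> {1, -1}"
    and pal: "palindromic_quadratic K n st eps A Q"
    and A_inv: "invertible_mat A"
    and std: "standard_pair K n st eps A Q X J"
    and p: "p \<le> 2 * n"
    and Y1: "Y1 \<in> mats K n p" and Y2: "Y2 \<in> mats K n (2 * n - p)"
    and L1: "L1 \<in> mats K p p" and L2: "L2 \<in> mats K (2 * n - p) (2 * n - p)"
    and J: "J = diag_block_mat [L1, L2]" and X: "X = Y1 @\<^sub>c Y2"
    and Lt1: "Lt1 \<in> mats K p p" "invertible_mat Lt1"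
    and lt: "spectrum Lt1 = lt ` {1..p}"
    and disj: "spectrum L1 \<inter> spectrum (st (minv L2)) = {}"
    and G1: "G1 = (st Y1 @\<^sub>c (st (minv L1) * st Y1)) * four_block_mat Q A A (0\<^sub>m n n)
                  * (Y1 @\<^sub>r (Y1 * L1))"
    and Gamma1: "Gamma1 = minv G1"
  shows "invertible_mat G1 \<and>
    (\<forall>Phi Gammat1 Yt1 M At Qt.
       Phi \<in> mats K p p \<and> invertible_mat Phi \<and>
       Gammat1 \<in> S_set K p st eps Lt1 \<and>
       Phi * Gammat1 * st Phi = Gamma1 \<and>
       Yt1 = Y1 * Phi \<and>
       M = minv A + (Yt1 * Lt1 * Gammat1 * st Yt1 - Y1 * L1 * Gamma1 * st Y1) \<and>
       invertible_mat M \<and>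
       At = minv M \<and>
       Qt = At * minv A * Q * minv A * At
            + At * (Y1 * (L1 * L1) * Gamma1 * st Y1 - Yt1 * (Lt1 * Lt1) * Gammat1 * st Yt1) * At
       \<longrightarrow> pmup_solution K n p st eps Yt1 Lt1 Y2 L2 At Qt)"
proof -
  interpret matrix_star st eps using st eps by unfold_locales
  define q where "q = 2 * n - p"
  have pq: "p + q = n + n" using p by (simp add: q_def)
  have Am: "A \<in> mats K n n" "Q \<in> mats K n n" and Qs: "st Q = eps \<cdot>\<^sub>m Q"
    using pal by (auto simp: palindromic_quadratic_def)
  have A: "A \<in> carrier_mat n n" "Q \<in> carrier_mat n n"
    and c1: "Y1 \<in> carrier_mat n p" "L1 \<in> carrier_mat p p"
    and c2: "Y2 \<in> carrier_mat n q" "L2 \<in> carrier_mat q q" and Lt: "Lt1 \<in> carrier_mat p p"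
    using Am Y1 Y2 L1 L2 Lt1 by (auto simp: mats_iff q_def)
  note Ai = minv[OF A(1) A_inv]
  note sp = standard_pair_blocks[OF std[unfolded X J] A c1 c2]
  note inv = standard_pair_invertible[OF A Ai(3,1) c1 c2 pq sp]
  note N1 = minv[OF c1(2) inv(1)] and N2 = minv[OF c2(2) inv(2)] and Nt = minv[OF Lt Lt1(2)]
  obtain g1 g2 where g: "g1 \<in> carrier_mat p p" "g2 \<in> carrier_mat q q"
    "gram A Q Y1 (minv L1) Y1 L1 * g1 = 1\<^sub>m p"
    and g2: "st g2 = (- eps) \<cdot>\<^sub>m g2" "L2 * g2 = g2 * st (minv L2)"
    and s: "Y1 * (g1 * st Y1) + Y2 * (g2 * st Y2) = 0\<^sub>m n n"
    "Y1 * (L1 * (g1 * st Y1)) + Y2 * (L2 * (g2 * st Y2)) = minv A"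
    "Y1 * (L1 * (L1 * (g1 * st Y1))) + Y2 * (L2 * (L2 * (g2 * st Y2)))
      = (- 1) \<cdot>\<^sub>m (minv A * (Q * minv A))"
    by (rule spectral_sums[OF A Ai(3,1,2) Qs c1 N1(3) c2 N2(3) pq N1(1) N2(1) sp disj])
  have G1b: "G1 = gram A Q Y1 (minv L1) Y1 L1"
    unfolding G1 gram_def using A c1 N1(3)
    by (simp add: append_cols_mult_block append_cols_mult_rows mat_alg)
  have G1c: "G1 \<in> carrier_mat p p"
    unfolding G1b gram_def using A c1 N1(3) by (auto intro!: carrier_matI)
  have G1g: "G1 * g1 = 1\<^sub>m p" using g(3) G1b by simp
  have G1inv: "invertible_mat G1"
    by (rule invertible_if_right_inverse[OF G1c g(1) G1g])
  have Gg: "Gamma1 = g1"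
    unfolding Gamma1 using inverse_unique[OF G1c g(1) minv(3)[OF G1c G1inv] G1g minv(2)[OF G1c G1inv]]
    by simp
  \<comment> \<open>\<open>Gamma1\<close> enters the new coefficients, which must have entries in \<open>K\<close>.\<close>
  have "G1 \<in> mats K p p"
    unfolding G1b gram_def
    by (intro mats_add[OF K] mats_mult[OF K] mats_star[OF K]) (rule Am Y1 L1 mats_minv[OF K L1 inv(1)])+
  then have Gm: "Gamma1 \<in> mats K p p"
    unfolding Gamma1 using G1inv by (intro mats_minv K)
  show ?thesis
  proof (intro conjI allI impI G1inv, elim conjE)
    fix Phi Gammat1 Yt1 M At Qt
    assume Phi: "Phi \<in> mats K p p" "invertible_mat Phi" and S: "Gammat1 \<in> S_set K p st eps Lt1"
      and PG: "Phi * Gammat1 * st Phi = Gamma1" and Yt: "Yt1 = Y1 * Phi"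
      and M: "M = minv A + (Yt1 * Lt1 * Gammat1 * st Yt1 - Y1 * L1 * Gamma1 * st Y1)"
      and Mi: "invertible_mat M" and At: "At = minv M"
      and Qt: "Qt = At * minv A * Q * minv A * At
            + At * (Y1 * (L1 * L1) * Gamma1 * st Y1 - Yt1 * (Lt1 * Lt1) * Gammat1 * st Yt1) * At"
    have gt: "Gammat1 \<in> mats K p p" "st Gammat1 = (- eps) \<cdot>\<^sub>m Gammat1"
      "Lt1 * Gammat1 = Gammat1 * st (minv Lt1)"
      using S by (auto simp: S_set_def)
    have Ytm: "Yt1 \<in> mats K n p" unfolding Yt by (rule mats_mult[OF K Y1 Phi(1)])
    note mm = mats_mult[OF K] mats_add[OF K] mats_star[OF K] K
    have Aim: "minv A \<in> mats K n n" by (rule mats_minv[OF K Am(1) A_inv])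
    have Mm: "M \<in> mats K n n"
      unfolding M by (intro mm) (rule Aim Ytm Lt1 gt Y1 L1 Gm)+
    have Atm: "At \<in> mats K n n" unfolding At by (rule mats_minv[OF K Mm Mi])
    have Qtm: "Qt \<in> mats K n n"
      unfolding Qt by (intro mm) (rule Aim Atm Am Ytm Lt1 gt Y1 L1 Gm)+
    have c: "Phi \<in> carrier_mat p p" "Gammat1 \<in> carrier_mat p p" "Yt1 \<in> carrier_mat n p"
      "M \<in> carrier_mat n n" "At \<in> carrier_mat n n" "Qt \<in> carrier_mat n n"
      using Phi gt Ytm Mm Atm Qtm by (auto simp: mats_iff)
    note MA = minv(1,2)[OF c(4) Mi, folded At]
    define P where "P = Y1 * (L1 * (L1 * (g1 * st Y1)))"
    define Pt where "Pt = Yt1 * (Lt1 * (Lt1 * (Gammat1 * st Yt1)))"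
    have Pc: "P \<in> carrier_mat n n" "Pt \<in> carrier_mat n n"
      using c c1 Lt g by (auto simp: P_def Pt_def intro!: carrier_matI)
    \<comment> \<open>The three moments of the updated data.\<close>
    have t0: "Yt1 * (Gammat1 * st Yt1) + Y2 * (g2 * st Y2) = 0\<^sub>m n n"
    proof -
      have "Yt1 * (Gammat1 * st Yt1) = Y1 * ((Phi * Gammat1 * st Phi) * st Y1)"
        unfolding Yt using c c1 by (simp add: star_mult mat_alg)
      then show ?thesis using s(1) by (simp add: PG Gg)
    qed
    have t1: "Yt1 * (Lt1 * (Gammat1 * st Yt1)) + Y2 * (L2 * (g2 * st Y2)) = M"
      unfolding M Gg s(2)[symmetric]
      by (rule eq_matI)
        (use c c1 c2 Lt g in \<open>auto simp: mult_assoc_dim simp del: index_mult_mat(1)\<close>)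
    have "Qt = At * (minv A * (Q * (minv A * At))) + At * ((P - Pt) * At)"
      unfolding Qt Gg P_def Pt_def using A Ai c c1 Lt g by (simp add: mult_assoc_dim)
    moreover have "dim_row (P - Pt) = n" "dim_col (P - Pt) = n" using Pc by auto
    ultimately have MQM: "M * (Qt * M) = minv A * (Q * minv A) + (P - Pt)"
      using A Ai(3) c
      by (simp add: mat_alg MA cancel_left_dim[OF MA(1)] cancel_left_dim[OF MA(2)])
    have t2: "Yt1 * (Lt1 * (Lt1 * (Gammat1 * st Yt1))) + Y2 * (L2 * (L2 * (g2 * st Y2)))
        = (- 1) \<cdot>\<^sub>m (M * (Qt * M))"
    proof (rule eq_matI)
      fix i j assume "i < dim_row ((- 1) \<cdot>\<^sub>m (M * (Qt * M)))" "j < dim_col ((- 1) \<cdot>\<^sub>m (M * (Qt * M)))"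
      then have ij: "i < n" "j < n" using c by auto
      then show "(Yt1 * (Lt1 * (Lt1 * (Gammat1 * st Yt1))) + Y2 * (L2 * (L2 * (g2 * st Y2)))) $$ (i, j)
        = ((- 1) \<cdot>\<^sub>m (M * (Qt * M))) $$ (i, j)"
        using arg_cong[OF s(3), of "\<lambda>B. B $$ (i, j)"] A Ai(3) c2 g Pc
        unfolding MQM P_def[symmetric] Pt_def[symmetric]
        by (simp add: algebra_simps eq_neg_iff_add_eq_0 del: index_mult_mat(1))
    qed (use c c2 g in auto)
    note sol = inverse_problem[OF c(4,5,6) MA c(3) Lt Nt(3) c(2) c2 N2(3) g(2) pq Nt(1) N2(1)
        gt(2,3) g2 t0 t1 t2]
    show "pmup_solution K n p st eps Yt1 Lt1 Y2 L2 At Qt"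
      using sol Atm Qtm by (simp add: pmup_solution_def palindromic_quadratic_def q_def)
  qed
qed

end
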